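(* Every element of the composition monoid $\mathcal{CM}(K)$ of the Kronecker quiver can be expressed uniquely as a product of the form $$(\underline{\dim}\,P(m_1))\ast\cdots\ast(\underline{\dim}\,P(m_a))\ast\delta_s\ast(\underline{\dim}\,I(n_1))\ast\cdots\ast(\underline{\dim}\,I(n_b))$$ with $a,b\ge 0$, $0\le m_1\le\cdots\le m_a$, $n_1\ge\cdots\ge n_b\ge 0$ and some $s\ge 0$.
   Context: Let $k$ be an algebraically closed field of characteristic zero and $K$ the Kronecker quiver $i\rightrightarrows j$. For a dimension vector $\alpha=(\alpha_i,\alpha_j)$, let $\mathrm{Rep}(\alpha)$ be the affine space of pairs of $\alpha_j\times\alpha_i$ matrices over $k$, with the action of $\mathrm{GL}(\alpha)=\mathrm{GL}(\alpha_i)\times\mathrm{GL}(\alpha_j)$ by base change, so that orbits correspond to isomorphism classes of representations of dimension vector $\alpha$. The extension monoid has as elements the irreducible closed $\mathrm{GL}(\alpha)$-stable subvarieties of $\mathrm{Rep}(\alpha)$, for all $\alpha$, with the product of $\mathcal{A}\subset\mathrm{Rep}(\alpha)$ and $\mathcal{B}\subset\mathrm{Rep}(\beta)$ given by $$\mathcal{A}\ast\mathcal{B}=\{X\in\mathrm{Rep}(\alpha+\beta): \exists\text{ an exact sequence }0\to B\to X\to A\to 0\text{ with }A\in\mathcal{A},B\in\mathcal{B}\},$$ and unit $\mathrm{Rep}(0)$ (this is a known well-defined monoid). The composition monoid $\mathcal{CM}(K)$ is the submonoid generated by $i:=\mathrm{Rep}((1,0))$ and $j:=\mathrm{Rep}((0,1))$.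 Write $(\alpha):=\mathrm{Rep}(\alpha)=i^{\alpha_i}j^{\alpha_j}$. $P(m)$ and $I(n)$ ($m,n\ge0$) are the indecomposable preprojective and preinjective representations, with $\underline{\dim}\,P(m)=(m,m+1)$, $\underline{\dim}\,I(n)=(n+1,n)$; $\delta_s:=i^sj^s=\mathrm{Rep}((s,s))$, so $\delta_0$ is the unit. *)

theory Defs
  imports
    "Jordan_Normal_Form.Matrix_Kernel"
    "HOL-Library.Product_Plus"
begin

section \<open>Representations of the Kronecker quiver\<close>

text \<open>
  A representation of the quiver with two arrows from \<open>i\<close> to \<open>j\<close> is a pair of matrices of the
  same size, with \<open>\<alpha>\<^sub>j\<close> rows and \<open>\<alpha>\<^sub>i\<close> columns. Matrices with no rows or no columns
  still carry both dimensions, so a representation determines its dimension vector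
  \<open>(\<alpha>\<^sub>i, \<alpha>\<^sub>j)\<close>, and the spaces \<open>Rep \<alpha>\<close> are pairwise disjoint.
\<close>

type_synonym 'a rep = "'a mat \<times> 'a mat"
type_synonym dimvec = "nat \<times> nat"

definition Rep :: "dimvec \<Rightarrow> 'a rep set" where
  "Rep \<alpha> = carrier_mat (snd \<alpha>) (fst \<alpha>) \<times> carrier_mat (snd \<alpha>) (fst \<alpha>)"

definition dimv :: "'a rep \<Rightarrow> dimvec" where
  "dimv X = (dim_col (fst X), dim_row (fst X))"

lemma dimv_Rep: "X \<in> Rep \<alpha> \<Longrightarrow> dimv X = \<alpha>"
  by (auto simp: Rep_def dimv_def)

text \<open>A morphism \<open>f\<close> consists of its matrix \<open>fst f\<close> at \<open>i\<close> and its matrix \<open>snd f\<close> at \<open>j\<close>.\<close>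

definition rep_hom :: "'a::field rep \<Rightarrow> 'a rep \<Rightarrow> ('a mat \<times> 'a mat) set" where
  "rep_hom X Y = {f.
     fst f \<in> carrier_mat (fst (dimv Y)) (fst (dimv X)) \<and>
     snd f \<in> carrier_mat (snd (dimv Y)) (snd (dimv X)) \<and>
     snd f * fst X = fst Y * fst f \<and>
     snd f * snd X = snd Y * fst f}"

text \<open>Exactness of \<open>0 \<rightarrow> k\<^sup>m \<rightarrow> k\<^sup>n \<rightarrow> k\<^sup>l \<rightarrow> 0\<close>, with maps given by matrices \<open>F\<close> and \<open>G\<close>.\<close>

definition exact_mats :: "'a::field mat \<Rightarrow> 'a mat \<Rightarrow> bool" where
  "exact_mats F G \<longleftrightarrow>
     inj_on (\<lambda>v. F *\<^sub>v v) (carrier_vec (dim_col F)) \<and>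
     (\<lambda>v. F *\<^sub>v v) ` carrier_vec (dim_col F) = mat_kernel G \<and>
     (\<lambda>v. G *\<^sub>v v) ` carrier_vec (dim_col G) = carrier_vec (dim_row G)"

text \<open>There is an exact sequence \<open>0 \<rightarrow> B \<rightarrow> X \<rightarrow> A \<rightarrow> 0\<close>.\<close>

definition is_extension :: "'a::field rep \<Rightarrow> 'a rep \<Rightarrow> 'a rep \<Rightarrow> bool" where
  "is_extension B X A \<longleftrightarrow>
     (\<exists>f \<in> rep_hom B X. \<exists>g \<in> rep_hom X A.
        exact_mats (fst f) (fst g) \<and> exact_mats (snd f) (snd g))"


section \<open>Irreducible closed stable subvarieties\<close>

text \<open>
  The functions given by polynomials in the matrix entries, and the closed sets of the Zariski
  topology as their common zero sets.
\<close>

inductive_set poly_funs :: "dimvec \<Rightarrow> ('a::field rep \<Rightarrow> 'a) set" for \<alpha> where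
  const: "(\<lambda>X. c) \<in> poly_funs \<alpha>"
| coord1: "r < snd \<alpha> \<Longrightarrow> c < fst \<alpha> \<Longrightarrow> (\<lambda>X. fst X $$ (r, c)) \<in> poly_funs \<alpha>"
| coord2: "r < snd \<alpha> \<Longrightarrow> c < fst \<alpha> \<Longrightarrow> (\<lambda>X. snd X $$ (r, c)) \<in> poly_funs \<alpha>"
| add: "p \<in> poly_funs \<alpha> \<Longrightarrow> q \<in> poly_funs \<alpha> \<Longrightarrow> (\<lambda>X. p X + q X) \<in> poly_funs \<alpha>"
| mult: "p \<in> poly_funs \<alpha> \<Longrightarrow> q \<in> poly_funs \<alpha> \<Longrightarrow> (\<lambda>X. p X * q X) \<in> poly_funs \<alpha>"

definition zariski_closed :: "dimvec \<Rightarrow> 'a::field rep set \<Rightarrow> bool" where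
  "zariski_closed \<alpha> Z \<longleftrightarrow>
     (\<exists>F \<subseteq> poly_funs \<alpha>. Z = {X \<in> Rep \<alpha>. \<forall>p\<in>F. p X = 0})"

definition zariski_irreducible :: "dimvec \<Rightarrow> 'a::field rep set \<Rightarrow> bool" where
  "zariski_irreducible \<alpha> Z \<longleftrightarrow> Z \<noteq> {} \<and>
     (\<forall>C D. zariski_closed \<alpha> C \<and> zariski_closed \<alpha> D \<and> Z \<subseteq> C \<union> D \<longrightarrow> Z \<subseteq> C \<or> Z \<subseteq> D)"

abbreviation GL :: "nat \<Rightarrow> 'a::field mat monoid" where
  "GL n \<equiv> units_of (ring_mat TYPE('a) n ())"

definition GL_stable :: "dimvec \<Rightarrow> 'a::field rep set \<Rightarrow> bool" where
  "GL_stable \<alpha> Z \<longleftrightarrow>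
     (\<forall>X\<in>Z. \<forall>g\<in>carrier (GL (fst \<alpha>)). \<forall>h\<in>carrier (GL (snd \<alpha>)).
        (h * fst X * inv\<^bsub>GL (fst \<alpha>)\<^esub> g, h * snd X * inv\<^bsub>GL (fst \<alpha>)\<^esub> g) \<in> Z)"


section \<open>The extension monoid and the composition monoid\<close>

definition ext_prod :: "'a::field rep set \<Rightarrow> 'a rep set \<Rightarrow> 'a rep set" where
  "ext_prod \<A> \<B> =
     {X. \<exists>A\<in>\<A>. \<exists>B\<in>\<B>. X \<in> Rep (dimv A + dimv B) \<and> is_extension B X A}"

definition ext_monoid :: "'a::field rep set monoid" where
  "ext_monoid =
     \<lparr> carrier = {Z. \<exists>\<alpha>. zariski_closed \<alpha> Z \<and> zariski_irreducible \<alpha> Z \<and> GL_stable \<alpha> Z},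
       monoid.mult = ext_prod,
       one = Rep (0, 0) \<rparr>"

text \<open>
  Closure under the operations alone: when the ambient structure is a monoid, this is the
  intersection of all submonoids containing the given subset of the carrier.
\<close>

inductive_set submonoid_generated :: "('a, 'b) monoid_scheme \<Rightarrow> 'a set \<Rightarrow> 'a set"
  for G and H where
  one: "\<one>\<^bsub>G\<^esub> \<in> submonoid_generated G H"
| incl: "h \<in> H \<Longrightarrow> h \<in> submonoid_generated G H"
| mult: "x \<in> submonoid_generated G H \<Longrightarrow> y \<in> submonoid_generated G H \<Longrightarrow>
           x \<otimes>\<^bsub>G\<^esub> y \<in> submonoid_generated G H"

lemma (in monoid) submonoid_generated_eq_Inter:
  assumes "H \<subseteq> carrier G"
  shows "submonoid_generated G H = \<Inter> {N. submonoid N G \<and> H \<subseteq> N}"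
proof
  show "submonoid_generated G H \<subseteq> \<Inter> {N. submonoid N G \<and> H \<subseteq> N}"
  proof
    fix x assume "x \<in> submonoid_generated G H"
    then show "x \<in> \<Inter> {N. submonoid N G \<and> H \<subseteq> N}"
      by induction (auto simp: submonoid.one_closed intro: submonoid.m_closed)
  qed
  have "x \<in> carrier G" if "x \<in> submonoid_generated G H" for x
    using that assms by induction auto
  then have "submonoid (submonoid_generated G H) G"
    by (auto intro!: submonoid.intro submonoid_generated.one submonoid_generated.mult)
  then show "\<Inter> {N. submonoid N G \<and> H \<subseteq> N} \<subseteq> submonoid_generated G H"
    by (auto intro: submonoid_generated.incl)
qed

definition composition_monoid :: "'a::field rep set set" where
  "composition_monoid = submonoid_generated ext_monoid {Rep (1, 0), Rep (0, 1)}"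

definition delta :: "nat \<Rightarrow> 'a::field rep set" where
  "delta s = Rep (1, 0) [^]\<^bsub>ext_monoid\<^esub> s \<otimes>\<^bsub>ext_monoid\<^esub> Rep (0, 1) [^]\<^bsub>ext_monoid\<^esub> s"

text \<open>
  The indecomposable preprojective and preinjective representations, in Kronecker's normal form:
  one arrow acts by the identity block, the other by the identity block shifted by one.
\<close>

definition preproj :: "nat \<Rightarrow> 'a::field rep" where
  "preproj m =
     (mat (m + 1) m (\<lambda>(r, c). if r = c then 1 else 0),
      mat (m + 1) m (\<lambda>(r, c). if r = c + 1 then 1 else 0))"

definition preinj :: "nat \<Rightarrow> 'a::field rep" where
  "preinj n =
     (mat n (n + 1) (\<lambda>(r, c). if c = r then 1 else 0),
      mat n (n + 1) (\<lambda>(r, c). if c = r + 1 then 1 else 0))"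

lemma dimv_preproj: "dimv (preproj m) = (m, m + 1)"
  and dimv_preinj: "dimv (preinj n) = (n + 1, n)"
  by (simp_all add: dimv_def preproj_def preinj_def)

end

theory Submission
  imports Defs "Jordan_Normal_Form.Char_Poly"
begin

text \<open>
  A product of spaces \<open>Rep \<alpha>\<close> consists of the representations with a filtration whose subquotients
  have the prescribed dimension vectors, and \<open>Rep \<alpha> * Rep \<beta> = Rep (\<alpha> + \<beta>)\<close> as soon as every
  representation of dimension \<open>\<alpha> + \<beta>\<close> has a subrepresentation of dimension \<open>\<beta>\<close>. Linear algebra gives
  this for \<open>\<delta>\<^sub>r * \<delta>\<^sub>s\<close> (an eigenvector of the pencil), for \<open>\<delta>\<^sub>r * P(m)\<close> (a kernel vector of one arrow)
  and for \<open>I(m) * I(n)\<close> with \<open>m \<le> n + 1\<close> (counting dimensions, there is a nonzero map from \<open>I(n)\<close>);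
  transposition is an antiautomorphism exchanging \<open>P\<close> and \<open>I\<close>. These relations turn \<open>i\<close> times a
  standard product into a standard product, up to sorting the factors, while multiplying by
  \<open>j = P(0)\<close> on the left changes nothing.

  For uniqueness, consider the maximum of \<open>(k + 1) c - (k + 2) d\<close> over the dimension vectors \<open>(c, d)\<close>
  of subrepresentations of \<open>X\<close>. Its minimum over \<open>X\<close> in a standard product is the sum of
  \<open>k + 1 - n\<close> over the indices \<open>n \<le> k\<close> of the factors \<open>I(n)\<close>. Hence the product determines these indices,
  by transposition those of the factors \<open>P(m)\<close>, and then \<open>s\<close> by its dimension vector.
\<close>

section \<open>Rank factorization and split exact sequences\<close>

text \<open>The relations are equalities of sets, so the subrepresentation must exist in every
  representation, degenerate ones included. For \<open>I(m) * I(n)\<close> this is the obstacle: the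
  image of a nonzero map from \<open>I(n)\<close> may be too small. It still has dimension
  \<open>(e, f)\<close> with \<open>f < e \<le> n + 1\<close>; adding sink vectors makes it
  \<open>(q + 1, q)\<close> with \<open>q \<le> n\<close>, and
  \<open>I(m + 1) * I(q) \<subseteq> I(m) * I(q + 1)\<close> moves the index up to \<open>n\<close>.
  The condition \<open>m \<le> n + 1\<close> says that such a map is subject to fewer equations than
  it has unknowns. In a product the right factor is the subrepresentation. Descending indices
  therefore place the factors \<open>I(n)\<close> with \<open>n \<le> k\<close> in a
  subrepresentation of every member. The functional has the value \<open>k + 1 - n\<close> on
  \<open>I(n)\<close>, \<open>- s\<close> on \<open>\<delta>_s\<close> and
  \<open>- (m + k + 2)\<close> on \<open>P(m)\<close>, so exactly this tail contributes positively.
  Subspaces are carried as matrices with one-sided inverses, which turns kernels, images and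
  complements into matrix identities.\<close>

lemma mat_assoc:
  "dim_col A = dim_row B \<Longrightarrow> dim_col B = dim_row C \<Longrightarrow> A * B * C = A * (B * (C :: 'a::semiring_0 mat))"
  by (rule assoc_mult_mat) auto

text \<open>Once \<open>mat_assoc\<close> has moved all parentheses to the right, a product
  \<open>A * B\<close> is no longer a subterm of a longer product; this form still applies
  there.\<close>

lemma mat_cancel:
  assumes "A * B = 1\<^sub>m n" "dim_col A = dim_row B" "dim_row C = n"
  shows "A * (B * C) = (C :: 'a::semiring_1 mat)"
proof -
  have "dim_col B = n" using assms(1) by (metis index_mult_mat(3) index_one_mat(3))
  then show ?thesis using mat_assoc[of A B C] assms by (simp add: left_mult_one_mat[of C n "dim_col C"])
qed

lemma mat_cancel_zero:
  assumes "A * B = 0\<^sub>m r n" "dim_col A = dim_row B" "dim_row C = n"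
  shows "A * (B * C) = (0\<^sub>m r (dim_col C) :: 'a::semiring_1 mat)"
proof -
  have "dim_col B = n" using assms(1) by (metis index_mult_mat(3) index_zero_mat(3))
  then show ?thesis using mat_assoc[of A B C] assms by (simp add: left_mult_zero_mat[of C n "dim_col C"])
qed

text \<open>The coordinate inclusion for \<open>m \<le> n\<close>, the projection to the first
  coordinates for \<open>n \<le> m\<close>.\<close>

definition delta_mat :: "nat \<Rightarrow> nat \<Rightarrow> 'a::{zero,one} mat" where
  "delta_mat n m = mat n m (\<lambda>(i, j). if i = j then 1 else 0)"

lemma delta_mat_carrier [simp]: "delta_mat n m \<in> carrier_mat n m"
  by (simp add: delta_mat_def)

lemma delta_mat_dim [simp]: "dim_row (delta_mat n m) = n" "dim_col (delta_mat n m) = m"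
  by (simp_all add: delta_mat_def)

lemma delta_mat_mult: "c \<le> n \<Longrightarrow> delta_mat c n * delta_mat n c = (1\<^sub>m c :: 'a::field mat)"
  by (rule eq_matI) (auto simp: delta_mat_def scalar_prod_def if_distrib cong: if_cong)

text \<open>Gauss-Jordan elimination gives \<open>M = Q * C\<close> with \<open>C\<close> in reduced
  echelon form, whose \<open>r\<close> nonzero rows form \<open>T\<close>. The columns of
  \<open>S\<close> are then a basis of the image of \<open>M\<close>, and the one-sided inverses
  allow cancelling \<open>S\<close> on the left and \<open>T\<close> on the right.\<close>

lemma rank_factorization:
  assumes M: "(M :: 'a::field mat) \<in> carrier_mat n c"
  obtains r S S' T T' where "S \<in> carrier_mat n r" "S' \<in> carrier_mat r n"
    "T \<in> carrier_mat r c" "T' \<in> carrier_mat c r" "M = S * T" "S' * S = 1\<^sub>m r" "T * T' = 1\<^sub>m r"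
proof -
  define C where "C = gauss_jordan_single M"
  note g = gauss_jordan_single[OF M C_def[symmetric]]
  note C = g(2)
  obtain P Q where PQ: "C = P * M" "P \<in> carrier_mat n n" "Q \<in> carrier_mat n n"
    "P * Q = 1\<^sub>m n" "Q * P = 1\<^sub>m n"
    using g(4) by blast
  obtain f where "pivot_fun C f c" using g(3) C unfolding row_echelon_form_def by auto
  then have f: "pivot_fun C f c" .
  note p = pivot_funD[OF carrier_matD(1)[OF C] f]
  obtain r where r: "r \<le> n" "\<And>i. i < n \<Longrightarrow> f i < c \<longleftrightarrow> i < r"
  proof -
    \<comment> \<open>The pivot function takes the value \<open>c\<close> exactly at zero rows;
      \<open>r\<close> is the first such row, or \<open>n\<close>.\<close>
    define r where "r = (LEAST i. i \<ge> n \<or> f i \<ge> c)"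
    have 1: "r \<ge> n \<or> f r \<ge> c" unfolding r_def by (rule LeastI[of _ n]) simp
    have 2: "r \<le> n" unfolding r_def by (rule Least_le) simp
    have 3: "f i < c" if "i < r" for i
      using not_less_Least[of i] that unfolding r_def by force
    have 4: "f i = c" if "r \<le> i" "i < n" for i
      using that
    proof (induction i rule: dec_induct)
      case base then show ?case using 1 p(1)[of r] by linarith
    next
      case (step k)
      then show ?case using p(3)[of k] p(1)[of "Suc k"] by force
    qed
    show ?thesis using that[OF 2] 3 4 by (metis linorder_not_le nat_less_le)
  qed
  define T where "T = mat r c (\<lambda>(i, j). C $$ (i, j))"
  \<comment> \<open>It selects the pivot columns, which are unit vectors in reduced form.\<close>
  define T' :: "'a mat" where "T' = mat c r (\<lambda>(i, j). if i = f j then 1 else 0)"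
  have CD: "C = delta_mat n r * T"
  proof (rule eq_matI)
    fix i j assume "i < dim_row (delta_mat n r * T)" "j < dim_col (delta_mat n r * T)"
    then have ij: "i < n" "j < c" by (auto simp: T_def)
    show "C $$ (i, j) = (delta_mat n r * T) $$ (i, j)"
    proof (cases "i < r")
      case True
      then show ?thesis using ij
        by (auto simp: delta_mat_def T_def scalar_prod_def if_distrib[of "\<lambda>x. x * _"] cong: if_cong)
    next
      case False
      then have "f i = c" using r ij p(1)[of i] by fastforce
      then show ?thesis using ij False p(2)[of i j]
        by (auto simp: delta_mat_def T_def scalar_prod_def intro!: sum.neutral)
    qed
  qed (use C in \<open>auto simp: T_def\<close>)
  have TT: "T * T' = 1\<^sub>m r"
  proof (rule eq_matI)
    fix i j assume "i < dim_row (1\<^sub>m r :: 'a mat)" "j < dim_col (1\<^sub>m r :: 'a mat)"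
    then have ij: "i < r" "j < r" by auto
    then have "f j < c" "i < n" "j < n" using r by auto
    then show "(T * T') $$ (i, j) = 1\<^sub>m r $$ (i, j)"
      using ij p(4)[of j] p(5)[of j i]
      by (auto simp: T_def T'_def scalar_prod_def if_distrib cong: if_cong)
  qed (auto simp: T_def T'_def)
  have T: "T \<in> carrier_mat r c" "T' \<in> carrier_mat c r" by (auto simp: T_def T'_def)
  show thesis
  proof (rule that[of "Q * delta_mat n r" r "delta_mat r n * P" T T'])
    have "Q * delta_mat n r * T = Q * C" unfolding CD using PQ T by (simp add: mat_assoc)
    also have "\<dots> = (Q * P) * M" unfolding PQ(1) using PQ(2,3) M by (simp add: mat_assoc)
    finally show "M = Q * delta_mat n r * T" unfolding PQ(5) using M by simp
    show "delta_mat r n * P * (Q * delta_mat n r) = 1\<^sub>m r"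
      using PQ(2,3) mat_cancel[OF PQ(4)] delta_mat_mult[OF r(1)] by (simp add: mat_assoc)
  qed (use T TT PQ in auto)
qed

section \<open>Complements of split subspaces\<close>

lemma trace_comm:
  assumes "(A :: 'a::comm_semiring_0 mat) \<in> carrier_mat n m" "B \<in> carrier_mat m n"
  shows "(\<Sum>i<n. (A * B) $$ (i, i)) = (\<Sum>i<m. (B * A) $$ (i, i))"
proof -
  have "(\<Sum>i<n. (A * B) $$ (i, i)) = (\<Sum>i<n. \<Sum>j<m. A $$ (i, j) * B $$ (j, i))"
    using assms by (intro sum.cong) (auto simp: scalar_prod_def lessThan_atLeast0)
  also have "\<dots> = (\<Sum>j<m. \<Sum>i<n. B $$ (j, i) * A $$ (i, j))"
    by (subst sum.swap) (simp add: mult.commute)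
  also have "\<dots> = (\<Sum>i<m. (B * A) $$ (i, i))"
    using assms by (intro sum.cong) (auto simp: scalar_prod_def lessThan_atLeast0)
  finally show ?thesis .
qed

text \<open>
  The matrices \<open>F\<close> and \<open>G\<close> are the maps of a short exact sequence of vector spaces, \<open>F'\<close> and \<open>G'\<close>
  those of a splitting.
\<close>

definition biprod :: "nat \<Rightarrow> nat \<Rightarrow> 'a::field mat \<Rightarrow> 'a mat \<Rightarrow> 'a mat \<Rightarrow> 'a mat \<Rightarrow> bool" where
  "biprod c e F F' G G' \<longleftrightarrow>
     F \<in> carrier_mat (c + e) c \<and> F' \<in> carrier_mat c (c + e) \<and>
     G \<in> carrier_mat e (c + e) \<and> G' \<in> carrier_mat (c + e) e \<and>
     F' * F = 1\<^sub>m c \<and> G * G' = 1\<^sub>m e \<and> G * F = 0\<^sub>m e c \<and> F' * G' = 0\<^sub>m c e \<and>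
     F * F' + G' * G = 1\<^sub>m (c + e)"

lemma biprod_sym: "biprod c e F F' G G' \<Longrightarrow> biprod e c G' G F' F"
  unfolding biprod_def by (auto simp: add.commute[of e c] comm_add_mat[of "G' * G" "c + e" "c + e"])

lemma biprod_transpose:
  assumes "biprod c e F F' G G'"
  shows "biprod e c G\<^sup>T G'\<^sup>T F\<^sup>T F'\<^sup>T"
proof -
  have z: "(0\<^sub>m n m)\<^sup>T = (0\<^sub>m m n :: 'a mat)" for n m by (rule eq_matI) auto
  note b = assms[unfolded biprod_def]
  have "G'\<^sup>T * G\<^sup>T = (G * G')\<^sup>T" "F\<^sup>T * F'\<^sup>T = (F' * F)\<^sup>T"
    "F\<^sup>T * G\<^sup>T = (G * F)\<^sup>T" "G'\<^sup>T * F'\<^sup>T = (F' * G')\<^sup>T"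
    "G\<^sup>T * G'\<^sup>T = (G' * G)\<^sup>T" "F'\<^sup>T * F\<^sup>T = (F * F')\<^sup>T"
    using b by (metis transpose_mult)+
  moreover have "(G' * G)\<^sup>T + (F * F')\<^sup>T = (F * F' + G' * G)\<^sup>T"
    using b by (metis add_carrier_mat comm_add_mat mult_carrier_mat transpose_add)
  ultimately show ?thesis using b unfolding biprod_def by (simp add: z add.commute[of e c])
qed

text \<open>Compare traces; this is where characteristic zero enters.\<close>

lemma idempotent_rank:
  assumes F: "(F :: 'a::field_char_0 mat) \<in> carrier_mat n c" "F' \<in> carrier_mat c n" "F' * F = 1\<^sub>m c"
  and G: "G \<in> carrier_mat e n" "G' \<in> carrier_mat n e" "G * G' = 1\<^sub>m e"
  and s: "F * F' + G' * G = 1\<^sub>m n"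
  shows "n = c + e"
proof -
  have "of_nat n = (\<Sum>i<n. (F * F' + G' * G) $$ (i, i))" unfolding s by simp
  also have "\<dots> = (\<Sum>i<n. (F * F') $$ (i, i)) + (\<Sum>i<n. (G' * G) $$ (i, i))"
    using F G by (subst sum.distrib[symmetric]) (intro sum.cong; simp)
  also have "\<dots> = of_nat c + of_nat e"
    using trace_comm[OF F(1,2)] trace_comm[OF G(2,1)] F(3) G(3) by simp
  finally show ?thesis by (metis of_nat_add of_nat_eq_iff)
qed

text \<open>The complement of the image of \<open>F\<close> is the image of the idempotent
  \<open>E = 1 - F * F'\<close>. In a factorization \<open>E = S * T\<close> both factors can be
  cancelled, so idempotency becomes \<open>T * S = 1\<close>.\<close>

lemma biprod_complete_mono:
  assumes F: "(F :: 'a::field_char_0 mat) \<in> carrier_mat n c" "F' \<in> carrier_mat c n" "F' * F = 1\<^sub>m c"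
  obtains e G G' where "n = c + e" "biprod c e F F' G G'"
proof -
  define E where "E = 1\<^sub>m n - F * F'"
  have Ec: "E \<in> carrier_mat n n" using F by (auto simp: E_def)
  have FF: "F * F' * F = F" using F by (simp add: mat_assoc)
  have FF': "F' * (F * F') = F'" using F by (simp add: mat_assoc[symmetric])
  have EF: "E * F = 0\<^sub>m n c"
    using F FF unfolding E_def by (subst minus_mult_distrib_mat[of _ n n]) auto
  have FE: "F' * E = 0\<^sub>m c n"
    using F FF' unfolding E_def by (subst mult_minus_distrib_mat[of _ c n]) auto
  have EE: "E * E = E"
  proof -
    have "E * E = E * 1\<^sub>m n - E * (F * F')"
      using F Ec by (subst mult_minus_distrib_mat[symmetric, of _ n n]) (auto simp: E_def)
    also have "E * (F * F') = 0\<^sub>m n n" using EF F Ec by (simp add: mat_assoc[symmetric])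
    finally show ?thesis using Ec by auto
  qed
  obtain r S S' T T' where R: "S \<in> carrier_mat n r" "S' \<in> carrier_mat r n"
    "T \<in> carrier_mat r n" "T' \<in> carrier_mat n r" "E = S * T" "S' * S = 1\<^sub>m r" "T * T' = 1\<^sub>m r"
    using rank_factorization[OF Ec] .
  have cS: "B = C" if "S * B = S * C" "B \<in> carrier_mat r k" "C \<in> carrier_mat r k" for B C k
  proof -
    have "S' * (S * B) = S' * (S * C)" using that by simp
    then show ?thesis using mat_cancel[OF R(6), of B] mat_cancel[OF R(6), of C] that(2,3) R(1,2) by simp
  qed
  have cT: "B = C" if "B * T = C * T" "B \<in> carrier_mat k r" "C \<in> carrier_mat k r" for B C k
  proof -
    have "B * (T * T') = C * (T * T')"
      using that(1) mat_assoc[of B T T'] mat_assoc[of C T T'] that(2,3) R(3,4) by simp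
    then show ?thesis unfolding R(7) using that(2,3) by simp
  qed
  have TS: "T * S = 1\<^sub>m r"
  proof (rule cS[OF cT])
    show "S * (T * S) * T = S * 1\<^sub>m r * T" using EE R by (simp add: mat_assoc)
  qed (use R in auto)
  have TF: "T * F = 0\<^sub>m r c"
    by (rule cS[of _ _ c]) (use EF R F in \<open>simp_all add: mat_assoc\<close>)
  have FS: "F' * S = 0\<^sub>m c r"
    by (rule cT[of _ _ c]) (use FE R F in \<open>simp_all add: mat_assoc\<close>)
  have sum: "F * F' + S * T = 1\<^sub>m n"
    unfolding R(5)[symmetric] E_def using F by (intro eq_matI) auto
  have n: "n = c + r" using idempotent_rank[OF F R(3,1) TS sum] .
  show thesis
    by (rule that[OF n, of T S]) (use n F R TS TF FS sum in \<open>simp add: biprod_def\<close>)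
qed

lemma biprod_complete_epi:
  assumes G: "(G :: 'a::field_char_0 mat) \<in> carrier_mat e n" "G' \<in> carrier_mat n e" "G * G' = 1\<^sub>m e"
  obtains c F F' where "n = c + e" "biprod c e F F' G G'"
  using biprod_complete_mono[OF G(2,1,3)] biprod_sym add.commute by metis

text \<open>Elimination of one unknown per equation. Arbitrary finite index sets allow pairs as
  indices, as needed when the unknowns are the entries of a matrix.\<close>

lemma homogeneous_system:
  fixes a :: "'j \<Rightarrow> 'i \<Rightarrow> 'a::field"
  assumes "finite J" "finite I" "card J < card I"
  shows "\<exists>x. (\<exists>i\<in>I. x i \<noteq> 0) \<and> (\<forall>j\<in>J. (\<Sum>i\<in>I. a j i * x i) = 0)"
  using assms
proof (induction J arbitrary: I a rule: finite_induct)
  case empty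
  then have "I \<noteq> {}" by auto
  then show ?case by (intro exI[of _ "\<lambda>_. 1"]) auto
next
  case (insert j J)
  show ?case
  proof (cases "\<forall>i\<in>I. a j i = 0")
    case True
    have "card J < card I" using insert.hyps insert.prems by simp
    then obtain x where "\<exists>i\<in>I. x i \<noteq> 0" "\<forall>j\<in>J. (\<Sum>i\<in>I. a j i * x i) = 0"
      using insert.IH[of I a] insert.prems by blast
    then show ?thesis using True by (intro exI[of _ x]) auto
  next
    case False
    then obtain i0 where i0: "i0 \<in> I" "a j i0 \<noteq> 0" by auto
    \<comment> \<open>The coefficient of unknown \<open>i\<close> in equation \<open>k\<close> after
      equation \<open>j\<close> has been solved for unknown \<open>i0\<close>.\<close>
    define b where "b k i = a k i - a k i0 * a j i / a j i0" for k i
    have "card J < card (I - {i0})" using insert i0 by (simp add: card_Diff_singleton)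
    then obtain x where x: "\<exists>i\<in>I - {i0}. x i \<noteq> 0" "\<forall>k\<in>J. (\<Sum>i\<in>I - {i0}. b k i * x i) = 0"
      using insert.IH[of "I - {i0}" b] insert.prems by blast
    define y where "y = x(i0 := - (\<Sum>i\<in>I - {i0}. a j i * x i) / a j i0)"
    have y: "(\<Sum>i\<in>I. a k i * y i) =
        (\<Sum>i\<in>I - {i0}. a k i * x i) - a k i0 * (\<Sum>i\<in>I - {i0}. a j i * x i) / a j i0" for k
      using insert.prems i0 by (subst sum.remove[of _ i0]) (auto simp: y_def intro!: sum.cong)
    have "(\<Sum>i\<in>I. a k i * y i) = 0" if "k \<in> insert j J" for k
    proof (cases "k = j")
      case True
      then show ?thesis using i0 by (simp add: y)
    next
      case False
      then have "(\<Sum>i\<in>I - {i0}. b k i * x i) = 0" using x that by auto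
      then show ?thesis unfolding y b_def
        by (simp add: left_diff_distrib sum_subtractf sum_distrib_left sum_divide_distrib mult.assoc)
    qed
    moreover have "\<exists>i\<in>I. y i \<noteq> 0" using x(1) by (auto simp: y_def)
    ultimately show ?thesis by blast
  qed
qed

lemma kernel_nontrivial:
  assumes A: "(A :: 'a::field mat) \<in> carrier_mat r c" and "r < c"
  obtains x where "x \<in> carrier_vec c" "x \<noteq> 0\<^sub>v c" "A *\<^sub>v x = 0\<^sub>v r"
proof -
  obtain y where y: "\<exists>i\<in>{..<c}. y i \<noteq> 0" "\<forall>j\<in>{..<r}. (\<Sum>i\<in>{..<c}. A $$ (j, i) * y i) = 0"
    using homogeneous_system[of "{..<r}" "{..<c}" "\<lambda>j i. A $$ (j, i)"] assms by auto
  have "A *\<^sub>v vec c y = 0\<^sub>v r"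
    using A y(2) by (intro eq_vecI) (auto simp: scalar_prod_def lessThan_atLeast0)
  moreover have "vec c y \<noteq> 0\<^sub>v c" using y(1) by (metis index_vec index_zero_vec(1) lessThan_iff)
  ultimately show thesis using that[of "vec c y"] by simp
qed

section \<open>Extensions in matrix form\<close>

text \<open>Exactness in the middle: what \<open>G\<close> kills factors through \<open>F\<close>,
  and \<open>F' * M\<close> is the factor. The next lemma is the dual factorization through
  \<open>G\<close>.\<close>

lemma biprod_absorb:
  assumes "biprod c e F F' G G'" "M \<in> carrier_mat (c + e) k" "G * M = 0\<^sub>m e k"
  shows "F * (F' * M) = M"
proof -
  note b = assms(1)[unfolded biprod_def]
  have "M = (F * F' + G' * G) * M" using b assms(2) by simp
  also have "\<dots> = F * F' * M + G' * G * M"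
    using b assms(2) by (intro add_mult_distrib_mat) auto
  also have "G' * G * M = 0\<^sub>m (c + e) k"
    using b assms(2,3) mat_assoc[of G' G M] by auto
  finally show ?thesis using b assms(2) mat_assoc[of F F' M] by auto
qed

lemma biprod_absorb':
  assumes "biprod c e F F' G G'" "M \<in> carrier_mat k (c + e)" "M * F = 0\<^sub>m k c"
  shows "M * (G' * G) = M"
proof -
  note b = assms(1)[unfolded biprod_def]
  have "M = M * (F * F' + G' * G)" using b assms(2) by simp
  also have "\<dots> = M * (F * F') + M * (G' * G)"
    using b assms(2) by (intro mult_add_distrib_mat) auto
  also have "M * (F * F') = 0\<^sub>m k (c + e)"
    using b assms(2,3) mat_assoc[of M F F'] by auto
  finally show ?thesis using b assms(2) by auto
qed

lemma inj_mat_cancel: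
  assumes F: "F \<in> carrier_mat n c" "inj_on (\<lambda>v. F *\<^sub>v v) (carrier_vec c)"
    and B: "B \<in> carrier_mat c k" "C \<in> carrier_mat c k" "F * B = F * C"
  shows "B = (C :: 'a::semiring_0 mat)"
proof (rule mat_col_eqI)
  fix j assume j: "j < dim_col C"
  have "F *\<^sub>v col B j = F *\<^sub>v col C j"
    using F B j col_mult2[of F n c B k j] col_mult2[of F n c C k j] by auto
  then show "col B j = col C j"
    using F(2) B(1,2) j by (auto dest!: inj_onD)
qed (use B in auto)

text \<open>Short exact sequences of vector spaces split. Preimages of unit vectors give
  \<open>G'\<close>; completing the pair \<open>G\<close>, \<open>G'\<close> yields some kernel
  inclusion \<open>H\<close>. Since \<open>F\<close> has the same image, \<open>F * V = H\<close>
  for a matrix \<open>V\<close>, and \<open>V * H'\<close> is the left inverse of \<open>F\<close>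
  that fits \<open>G'\<close>.\<close>

lemma exact_mats_iff_biprod:
  assumes F: "(F :: 'a::field_char_0 mat) \<in> carrier_mat (c + e) c" and G: "G \<in> carrier_mat e (c + e)"
  shows "exact_mats F G \<longleftrightarrow> (\<exists>F' G'. biprod c e F F' G G')"
proof
  assume ex: "exact_mats F G"
  have inj: "inj_on (\<lambda>v. F *\<^sub>v v) (carrier_vec c)"
    and im: "(\<lambda>v. F *\<^sub>v v) ` carrier_vec c = mat_kernel G"
    and surj: "(\<lambda>v. G *\<^sub>v v) ` carrier_vec (c + e) = carrier_vec e"
    using ex F G unfolding exact_mats_def by auto
  have "\<exists>u. u \<in> carrier_vec (c + e) \<and> G *\<^sub>v u = unit_vec e j" if "j < e" for j
    using surj that by (metis imageE unit_vec_carrier)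
  then obtain u where u: "\<And>j. j < e \<Longrightarrow> u j \<in> carrier_vec (c + e) \<and> G *\<^sub>v u j = unit_vec e j"
    by metis
  define G' where "G' = mat_of_cols (c + e) (map u [0..<e])"
  have G': "G' \<in> carrier_mat (c + e) e"
    unfolding G'_def using mat_of_cols_carrier(1)[of "c + e" "map u [0..<e]"] by simp
  have colG': "col G' j = u j" if "j < e" for j using u that unfolding G'_def by simp
  have GG': "G * G' = 1\<^sub>m e"
  proof (rule mat_col_eqI)
    fix j assume "j < dim_col (1\<^sub>m e :: 'a mat)"
    then have j: "j < e" by simp
    show "col (G * G') j = col (1\<^sub>m e) j"
      unfolding col_mult2[OF G G' j] colG'[OF j] using u[OF j] j by simp
  qed (use G G' in auto)
  obtain c0 H H' where "c + e = c0 + e" "biprod c0 e H H' G G'"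
    using biprod_complete_epi[OF G G' GG'] .
  then have b: "biprod c e H H' G G'" by simp
  note b' = b[unfolded biprod_def]
  have GF: "G * F = 0\<^sub>m e c"
  proof (rule mat_col_eqI)
    fix j assume "j < dim_col (0\<^sub>m e c :: 'a mat)"
    then have j: "j < c" by simp
    have "col F j = F *\<^sub>v unit_vec c j" using F j col_mult2[of F "c + e" c "1\<^sub>m c" c j] by simp
    then have "col F j \<in> mat_kernel G" using im j by auto
    then have z: "G *\<^sub>v col F j = 0\<^sub>v e" using G by (simp add: mat_kernel_def)
    show "col (G * F) j = col (0\<^sub>m e c) j"
      unfolding col_mult2[OF G F j] z using j by simp
  qed (use F G in auto)
  have "\<exists>v. v \<in> carrier_vec c \<and> F *\<^sub>v v = col H j" if "j < c" for j
  proof -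
    have "G *\<^sub>v col H j = 0\<^sub>v e" using b' that by (metis col_mult2 col_zero)
    then have "col H j \<in> mat_kernel G" using b' G that by (auto simp: mat_kernel_def)
    then show ?thesis using im by (metis imageE)
  qed
  then obtain v where v: "\<And>j. j < c \<Longrightarrow> v j \<in> carrier_vec c \<and> F *\<^sub>v v j = col H j" by metis
  define V where "V = mat_of_cols c (map v [0..<c])"
  have V: "V \<in> carrier_mat c c"
    unfolding V_def using mat_of_cols_carrier(1)[of c "map v [0..<c]"] by simp
  have colV: "col V j = v j" if "j < c" for j using v that unfolding V_def by simp
  have FV: "F * V = H"
  proof (rule mat_col_eqI)
    fix j assume "j < dim_col H"
    then have j: "j < c" using b' by auto
    show "col (F * V) j = col H j"
      unfolding col_mult2[OF F V j] colV[OF j] using v[OF j] by simp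
  qed (use F V b' in auto)
  have HF: "H * (H' * F) = F" by (rule biprod_absorb[OF b F GF])
  have "F * (V * (H' * F)) = F * 1\<^sub>m c"
    using HF FV F V b' mat_assoc[of F V "H' * F"] by auto
  then have VHF: "V * H' * F = 1\<^sub>m c"
    using inj_mat_cancel[OF F inj, of "V * (H' * F)" c "1\<^sub>m c"] F V b' by (auto simp: mat_assoc)
  have "biprod c e F (V * H') G G'"
    unfolding biprod_def
    using F V b' GF VHF FV mat_assoc[of F V H'] mat_assoc[of V H' G'] by auto
  then show "\<exists>F' G'. biprod c e F F' G G'" by blast
next
  assume "\<exists>F' G'. biprod c e F F' G G'"
  then obtain F' G' where b: "biprod c e F F' G G'" by blast
  note b' = b[unfolded biprod_def]
  have l: "F' *\<^sub>v (F *\<^sub>v v) = v" if "v \<in> carrier_vec c" for v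
    using b' that by (metis assoc_mult_mat_vec one_mult_mat_vec)
  have r: "G *\<^sub>v (G' *\<^sub>v v) = v" if "v \<in> carrier_vec e" for v
    using b' that by (metis assoc_mult_mat_vec one_mult_mat_vec)
  have z: "G *\<^sub>v (F *\<^sub>v v) = 0\<^sub>v e" if "v \<in> carrier_vec c" for v
    proof -
    have "G *\<^sub>v (F *\<^sub>v v) = 0\<^sub>m e c *\<^sub>v v"
      using b' that assoc_mult_mat_vec[of G e "c + e" F c v] by simp
    also have "\<dots> = 0\<^sub>v e" using that by (intro eq_vecI) auto
    finally show ?thesis .
  qed
  have s: "v = F *\<^sub>v (F' *\<^sub>v v)" if "v \<in> carrier_vec (c + e)" "G *\<^sub>v v = 0\<^sub>v e" for v
  proof -
    have "v = (F * F' + G' * G) *\<^sub>v v" using b' that by simp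
    also have "\<dots> = F * F' *\<^sub>v v + G' * G *\<^sub>v v"
      using b' that by (intro add_mult_distrib_mat_vec) auto
    also have "G' * G *\<^sub>v v = 0\<^sub>v (c + e)"
      using b' that assoc_mult_mat_vec[of G' "c + e" e G "c + e" v] by auto
    also have "F * F' *\<^sub>v v = F *\<^sub>v (F' *\<^sub>v v)" using b' that by (metis assoc_mult_mat_vec)
    finally have "v = F *\<^sub>v (F' *\<^sub>v v) + 0\<^sub>v (c + e)" .
    moreover have "F *\<^sub>v (F' *\<^sub>v v) \<in> carrier_vec (c + e)" using F by (simp add: carrier_vecI)
    ultimately show ?thesis by (metis right_zero_vec)
  qed
  show "exact_mats F G"
    unfolding exact_mats_def
  proof (intro conjI)
    show "inj_on (\<lambda>v. F *\<^sub>v v) (carrier_vec (dim_col F))"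
      using l F by (metis carrier_matD(2) inj_on_inverseI)
    show "(\<lambda>v. F *\<^sub>v v) ` carrier_vec (dim_col F) = mat_kernel G"
    proof
      show "(\<lambda>v. F *\<^sub>v v) ` carrier_vec (dim_col F) \<subseteq> mat_kernel G"
        using z F G by (auto simp: mat_kernel_def)
      show "mat_kernel G \<subseteq> (\<lambda>v. F *\<^sub>v v) ` carrier_vec (dim_col F)"
      proof
        fix v assume "v \<in> mat_kernel G"
        then have v: "v \<in> carrier_vec (c + e)" "G *\<^sub>v v = 0\<^sub>v e" using G by (auto simp: mat_kernel_def)
        have "F' *\<^sub>v v \<in> carrier_vec (dim_col F)" using b' v F by auto
        then show "v \<in> (\<lambda>v. F *\<^sub>v v) ` carrier_vec (dim_col F)" using s[OF v] by blast
      qed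
    qed
    show "(\<lambda>v. G *\<^sub>v v) ` carrier_vec (dim_col G) = carrier_vec (dim_row G)"
    proof
      show "(\<lambda>v. G *\<^sub>v v) ` carrier_vec (dim_col G) \<subseteq> carrier_vec (dim_row G)" using G by auto
      show "carrier_vec (dim_row G) \<subseteq> (\<lambda>v. G *\<^sub>v v) ` carrier_vec (dim_col G)"
      proof
        fix v :: "'a vec" assume "v \<in> carrier_vec (dim_row G)"
        then have v: "v \<in> carrier_vec e" using G by auto
        have "G' *\<^sub>v v \<in> carrier_vec (dim_col G)" using b' G v by auto
        then show "v \<in> (\<lambda>v. G *\<^sub>v v) ` carrier_vec (dim_col G)" using r[OF v] by (metis imageI)
      qed
    qed
  qed
qed

text \<open>The two projections index the two arrows, so that a condition on both is stated and
  proved once for a variable \<open>K\<close>.\<close>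

abbreviation arrows :: "('a mat \<times> 'a mat \<Rightarrow> 'a mat) set" where
  "arrows \<equiv> {fst, snd}"

definition map_rep :: "('a mat \<Rightarrow> 'a mat) \<Rightarrow> 'a rep \<Rightarrow> 'a rep" where
  "map_rep f X = (f (fst X), f (snd X))"

lemma arrow_map_rep: "K \<in> arrows \<Longrightarrow> K (map_rep f X) = f (K X)"
  by (auto simp: map_rep_def)

lemma arrow_Rep: "X \<in> Rep (a, b) \<Longrightarrow> K \<in> arrows \<Longrightarrow> K X \<in> carrier_mat b a"
  by (auto simp: Rep_def)

lemma RepI:
  assumes "\<And>K. K \<in> arrows \<Longrightarrow> K X \<in> carrier_mat b a"
  shows "X \<in> Rep (a, b)"
  using assms[of fst] assms[of snd] by (simp add: Rep_def mem_Times_iff)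

definition intertwines :: "'a::field rep \<Rightarrow> 'a mat \<Rightarrow> 'a mat \<Rightarrow> 'a rep \<Rightarrow> bool" where
  "intertwines X f g Y \<longleftrightarrow> (\<forall>K\<in>arrows. g * K X = K Y * f)"

text \<open>Only the linear maps at the two vertices are split here; the splittings
  \<open>Fi'\<close>, \<open>Gi'\<close>, \<open>Fj'\<close>, \<open>Gj'\<close> need not commute
  with the arrows.\<close>

lemma ext_prod_iff:
  assumes "\<A> \<subseteq> (\<Union>\<alpha>. Rep \<alpha>)" "\<B> \<subseteq> (\<Union>\<alpha>. Rep \<alpha>)"
  shows "(X :: 'a::field_char_0 rep) \<in> ext_prod \<A> \<B> \<longleftrightarrow>
    (\<exists>A\<in>\<A>. \<exists>B\<in>\<B>. \<exists>a b c d Fi Fi' Gi Gi' Fj Fj' Gj Gj'.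
       A \<in> Rep (a, b) \<and> B \<in> Rep (c, d) \<and> X \<in> Rep (c + a, d + b) \<and>
       biprod c a Fi Fi' Gi Gi' \<and> biprod d b Fj Fj' Gj Gj' \<and>
       intertwines B Fi Fj X \<and> intertwines X Gi Gj A)"
proof
  assume "X \<in> ext_prod \<A> \<B>"
  then obtain A B where AB: "A \<in> \<A>" "B \<in> \<B>" "X \<in> Rep (dimv A + dimv B)" "is_extension B X A"
    unfolding ext_prod_def by blast
  obtain a b c d where R: "A \<in> Rep (a, b)" "B \<in> Rep (c, d)" using AB assms by fast
  have X: "X \<in> Rep (c + a, d + b)" using AB(3) dimv_Rep[OF R(1)] dimv_Rep[OF R(2)] by (simp add: add.commute)
  obtain f g where fg: "f \<in> rep_hom B X" "g \<in> rep_hom X A"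
    "exact_mats (fst f) (fst g)" "exact_mats (snd f) (snd g)"
    using AB(4) unfolding is_extension_def by blast
  have F: "fst f \<in> carrier_mat (c + a) c" "snd f \<in> carrier_mat (d + b) d"
    and G: "fst g \<in> carrier_mat a (c + a)" "snd g \<in> carrier_mat b (d + b)"
    and I: "intertwines B (fst f) (snd f) X" "intertwines X (fst g) (snd g) A"
    using fg(1,2) dimv_Rep[OF R(1)] dimv_Rep[OF R(2)] dimv_Rep[OF X]
    by (auto simp: rep_hom_def intertwines_def)
  from fg(3,4) I R X AB(1,2) show "\<exists>A\<in>\<A>. \<exists>B\<in>\<B>. \<exists>a b c d Fi Fi' Gi Gi' Fj Fj' Gj Gj'.
       A \<in> Rep (a, b) \<and> B \<in> Rep (c, d) \<and> X \<in> Rep (c + a, d + b) \<and>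
       biprod c a Fi Fi' Gi Gi' \<and> biprod d b Fj Fj' Gj Gj' \<and>
       intertwines B Fi Fj X \<and> intertwines X Gi Gj A"
    unfolding exact_mats_iff_biprod[OF F(1) G(1)] exact_mats_iff_biprod[OF F(2) G(2)] by blast
next
  assume "\<exists>A\<in>\<A>. \<exists>B\<in>\<B>. \<exists>a b c d Fi Fi' Gi Gi' Fj Fj' Gj Gj'.
       A \<in> Rep (a, b) \<and> B \<in> Rep (c, d) \<and> X \<in> Rep (c + a, d + b) \<and>
       biprod c a Fi Fi' Gi Gi' \<and> biprod d b Fj Fj' Gj Gj' \<and>
       intertwines B Fi Fj X \<and> intertwines X Gi Gj A"
  then obtain A B a b c d Fi Fi' Gi Gi' Fj Fj' Gj Gj' where
    AB: "A \<in> \<A>" "B \<in> \<B>" and R: "A \<in> Rep (a, b)" "B \<in> Rep (c, d)" and X: "X \<in> Rep (c + a, d + b)"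
    and b: "biprod c a Fi Fi' Gi Gi'" "biprod d b Fj Fj' Gj Gj'"
    and I: "intertwines B Fi Fj X" "intertwines X Gi Gj A" by blast
  note b' = b[unfolded biprod_def]
  have e: "exact_mats Fi Gi" "exact_mats Fj Gj"
    using exact_mats_iff_biprod[of Fi c a Gi] exact_mats_iff_biprod[of Fj d b Gj] b b' by blast+
  have h: "(Fi, Fj) \<in> rep_hom B X" "(Gi, Gj) \<in> rep_hom X A"
    using I b' dimv_Rep[OF R(1)] dimv_Rep[OF R(2)] dimv_Rep[OF X]
    by (auto simp: rep_hom_def intertwines_def)
  have "is_extension B X A" using h e unfolding is_extension_def by force
  moreover have "X \<in> Rep (dimv A + dimv B)"
    using X dimv_Rep[OF R(1)] dimv_Rep[OF R(2)] by (simp add: add.commute)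
  ultimately show "X \<in> ext_prod \<A> \<B>" using AB unfolding ext_prod_def by blast
qed

lemma ext_prodE:
  assumes "(X :: 'a::field_char_0 rep) \<in> ext_prod \<A> \<B>" "\<A> \<subseteq> (\<Union>\<alpha>. Rep \<alpha>)" "\<B> \<subseteq> (\<Union>\<alpha>. Rep \<alpha>)"
  obtains A B a b c d Fi Fi' Gi Gi' Fj Fj' Gj Gj' where
    "A \<in> \<A>" "B \<in> \<B>" "A \<in> Rep (a, b)" "B \<in> Rep (c, d)" "X \<in> Rep (c + a, d + b)"
    "biprod c a Fi Fi' Gi Gi'" "biprod d b Fj Fj' Gj Gj'"
    "intertwines B Fi Fj X" "intertwines X Gi Gj A"
  using assms(1) unfolding ext_prod_iff[OF assms(2,3)] by blast

lemma ext_prodI: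
  assumes "A \<in> \<A>" "B \<in> \<B>" "A \<in> Rep (a, b)" "B \<in> Rep (c, d)"
    "(X :: 'a::field_char_0 rep) \<in> Rep (c + a, d + b)"
    "biprod c a Fi Fi' Gi Gi'" "biprod d b Fj Fj' Gj Gj'"
    "intertwines B Fi Fj X" "intertwines X Gi Gj A"
  shows "X \<in> ext_prod \<A> \<B>"
proof -
  have "X \<in> ext_prod {A} {B}"
    using assms by (subst ext_prod_iff) (fast, fast, blast)
  then show ?thesis using assms(1,2) by (auto simp: ext_prod_def)
qed

lemma ext_prod_mono: "\<A> \<subseteq> \<A>' \<Longrightarrow> \<B> \<subseteq> \<B>' \<Longrightarrow> ext_prod \<A> \<B> \<subseteq> ext_prod \<A>' \<B>'"
  unfolding ext_prod_def by blast

lemma ext_prod_Reps: "ext_prod \<A> \<B> \<subseteq> (\<Union>\<alpha>. Rep \<alpha>)"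
  unfolding ext_prod_def by blast

lemma ext_prod_Rep_subset: "ext_prod (Rep \<alpha>) (Rep \<beta>) \<subseteq> Rep (\<alpha> + \<beta>)"
  unfolding ext_prod_def by (auto dest!: dimv_Rep)

text \<open>Given a subspace \<open>F\<close> and a subspace \<open>f\<close> of the quotient by it,
  the kernel \<open>N\<close> of the composite projection \<open>g * G\<close> is the preimage of
  \<open>f\<close>. It contains the image of \<open>F\<close>, with a quotient of dimension
  \<open>b\<close>.\<close>

lemma biprod_refine:
  fixes F :: "'a::field_char_0 mat"
  assumes F: "biprod c (b + a) F F' G G'" and f: "biprod b a f f' g g'"
  obtains N N' where "biprod (c + b) a N N' (g * G) (G' * g')"
    "biprod c b (N' * F) (F' * N) (f' * G * N) (N' * (G' * f))"
proof -
  note F' = F[unfolded biprod_def] and f' = f[unfolded biprod_def]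
  have cF: "F \<in> carrier_mat (c + (b + a)) c" "F' \<in> carrier_mat c (c + (b + a))"
    "G \<in> carrier_mat (b + a) (c + (b + a))" "G' \<in> carrier_mat (c + (b + a)) (b + a)"
    and cf: "f \<in> carrier_mat (b + a) b" "f' \<in> carrier_mat b (b + a)"
    "g \<in> carrier_mat a (b + a)" "g' \<in> carrier_mat (b + a) a" using F' f' by auto
  have eF: "F' * F = 1\<^sub>m c" "G * G' = 1\<^sub>m (b + a)" "G * F = 0\<^sub>m (b + a) c" "F' * G' = 0\<^sub>m c (b + a)"
    "F * F' + G' * G = 1\<^sub>m (c + (b + a))"
    and ef: "f' * f = 1\<^sub>m b" "g * g' = 1\<^sub>m a" "g * f = 0\<^sub>m a b" "f' * g' = 0\<^sub>m b a" using F' f' by auto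
  have gG: "g * G \<in> carrier_mat a (c + (b + a))" "G' * g' \<in> carrier_mat (c + (b + a)) a"
    using cF cf by auto
  have one: "(g * G) * (G' * g') = 1\<^sub>m a"
    using cF cf ef mat_cancel[OF eF(2), of g'] by (simp add: mat_assoc)
  obtain k N N' where k: "c + (b + a) = k + a" and "biprod k a N N' (g * G) (G' * g')"
    using biprod_complete_epi[OF gG one] .
  then have N: "biprod (c + b) a N N' (g * G) (G' * g')" by (metis add.assoc add_right_imp_eq)
  have cN: "N \<in> carrier_mat (c + b + a) (c + b)" "N' \<in> carrier_mat (c + b) (c + b + a)"
    and eN: "N' * N = 1\<^sub>m (c + b)" "g * G * N = 0\<^sub>m a (c + b)" using N unfolding biprod_def by auto
  note cN' = cN[unfolded add.assoc]
  have NF: "N * (N' * F) = F"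
    using biprod_absorb[OF N, of F c] cF cf eF by (simp add: mat_assoc add.assoc)
  have Nf: "N * (N' * (G' * f)) = G' * f"
    using biprod_absorb[OF N, of "G' * f" b] cF cf ef(3) mat_cancel[OF eF(2), of f]
    by (simp add: mat_assoc add.assoc)
  have fGN: "f * (f' * (G * N)) = G * N"
    using biprod_absorb[OF f, of "G * N" "c + b"] cF cf cN' eN by (simp add: mat_assoc add.assoc)
  have "N' * F * (F' * N) + N' * (G' * f) * (f' * G * N) = N' * (F * F' * N) + N' * (G' * G * N)"
    using cF cf cN' fGN by (simp add: mat_assoc add.assoc)
  also have "\<dots> = N' * ((F * F' + G' * G) * N)"
    using cF cf cN' by (subst add_mult_distrib_mat[of _ "c + (b + a)" "c + (b + a)"], auto)
      (subst mult_add_distrib_mat[of _ "c + b" "c + (b + a)"], auto)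
  also have "\<dots> = 1\<^sub>m (c + b)" unfolding eF(5) using cN' eN by simp
  finally have s: "N' * F * (F' * N) + N' * (G' * f) * (f' * G * N) = 1\<^sub>m (c + b)" .
  have "biprod c b (N' * F) (F' * N) (f' * G * N) (N' * (G' * f))"
    unfolding biprod_def
    using s cF cf cN' NF Nf eF ef mat_cancel[OF eF(2), of f] mat_cancel_zero[OF eF(4), of f]
    by (simp add: mat_assoc)
  then show thesis using that N by blast
qed

text \<open>If \<open>C\<close> is a subrepresentation of \<open>X\<close> with quotient
  \<open>Y\<close>, and \<open>B\<close> one of \<open>Y\<close> with quotient \<open>A\<close>,
  then the kernel \<open>Z\<close> of \<open>X \<rightarrow> Y \<rightarrow> A\<close> contains
  \<open>C\<close> with quotient \<open>B\<close>, and \<open>X\<close> modulo \<open>Z\<close> is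
  \<open>A\<close>.\<close>

lemma ext_prod_assoc_subset:
  fixes \<A> :: "'a::field_char_0 rep set"
  assumes "\<A> \<subseteq> (\<Union>\<alpha>. Rep \<alpha>)" "\<B> \<subseteq> (\<Union>\<alpha>. Rep \<alpha>)" "\<C> \<subseteq> (\<Union>\<alpha>. Rep \<alpha>)"
  shows "ext_prod (ext_prod \<A> \<B>) \<C> \<subseteq> ext_prod \<A> (ext_prod \<B> \<C>)"
proof
  fix X assume "X \<in> ext_prod (ext_prod \<A> \<B>) \<C>"
  then obtain Y C yi yj ci cj Fi Fi' Gi Gi' Fj Fj' Gj Gj' where
    YC: "Y \<in> ext_prod \<A> \<B>" "C \<in> \<C>" and Y: "Y \<in> Rep (yi, yj)" and C: "C \<in> Rep (ci, cj)"
    and X: "X \<in> Rep (ci + yi, cj + yj)"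
    and F: "biprod ci yi Fi Fi' Gi Gi'" "biprod cj yj Fj Fj' Gj Gj'"
    and I: "intertwines C Fi Fj X" "intertwines X Gi Gj Y"
    using ext_prodE[OF _ ext_prod_Reps assms(3)] by metis
  from YC(1) obtain A B ai aj bi bj fi fi' gi gi' fj fj' gj gj' where
    AB: "A \<in> \<A>" "B \<in> \<B>" and A: "A \<in> Rep (ai, aj)" and B: "B \<in> Rep (bi, bj)"
    and Y': "Y \<in> Rep (bi + ai, bj + aj)"
    and f: "biprod bi ai fi fi' gi gi'" "biprod bj aj fj fj' gj gj'"
    and J: "intertwines B fi fj Y" "intertwines Y gi gj A"
    using ext_prodE[OF _ assms(1,2)] by metis
  have y: "yi = bi + ai" "yj = bj + aj" using dimv_Rep[OF Y] dimv_Rep[OF Y'] by auto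
  note F = F[unfolded y] and X = X[unfolded y]
  obtain Ni Ni' where N1: "biprod (ci + bi) ai Ni Ni' (gi * Gi) (Gi' * gi')"
    "biprod ci bi (Ni' * Fi) (Fi' * Ni) (fi' * Gi * Ni) (Ni' * (Gi' * fi))"
    using biprod_refine[OF F(1) f(1)] .
  obtain Nj Nj' where N2: "biprod (cj + bj) aj Nj Nj' (gj * Gj) (Gj' * gj')"
    "biprod cj bj (Nj' * Fj) (Fj' * Nj) (fj' * Gj * Nj) (Nj' * (Gj' * fj))"
    using biprod_refine[OF F(2) f(2)] .
  define Z where "Z = map_rep (\<lambda>M. Nj' * M * Ni) X"
  note bs = F[unfolded biprod_def] f[unfolded biprod_def] N1[unfolded biprod_def] N2[unfolded biprod_def]
  have car: "Fi \<in> carrier_mat (ci + (bi + ai)) ci" "Fj \<in> carrier_mat (cj + (bj + aj)) cj"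
    "Gi \<in> carrier_mat (bi + ai) (ci + (bi + ai))" "Gj \<in> carrier_mat (bj + aj) (cj + (bj + aj))"
    "fi \<in> carrier_mat (bi + ai) bi" "fj \<in> carrier_mat (bj + aj) bj"
    "fi' \<in> carrier_mat bi (bi + ai)" "fj' \<in> carrier_mat bj (bj + aj)"
    "gi \<in> carrier_mat ai (bi + ai)" "gj \<in> carrier_mat aj (bj + aj)"
    "Ni \<in> carrier_mat (ci + (bi + ai)) (ci + bi)" "Nj \<in> carrier_mat (cj + (bj + aj)) (cj + bj)"
    "Ni' \<in> carrier_mat (ci + bi) (ci + (bi + ai))" "Nj' \<in> carrier_mat (cj + bj) (cj + (bj + aj))"
    using bs by (auto simp: add.assoc)
  have eqs: "gi * Gi * Ni = 0\<^sub>m ai (ci + bi)" "Gi * Fi = 0\<^sub>m (bi + ai) ci" "fj' * fj = 1\<^sub>m bj"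
    using bs by auto
  have NF: "Ni * (Ni' * Fi) = Fi"
    using biprod_absorb[OF N1(1), of Fi ci] car eqs by (simp add: mat_assoc add.assoc)
  have fGN: "fi * (fi' * (Gi * Ni)) = Gi * Ni"
    using biprod_absorb[OF f(1), of "Gi * Ni" "ci + bi"] car eqs by (simp add: mat_assoc add.assoc)
  have K: "Nj * (Nj' * (K X * Ni)) = K X * Ni \<and>
      gj * Gj * K X = K A * (gi * Gi) \<and> Nj * K Z = K X * Ni \<and>
      (Nj' * Fj) * K C = K Z * (Ni' * Fi) \<and>
      (fj' * Gj * Nj) * K Z = K B * (fi' * Gi * Ni)" if K: "K \<in> arrows" for K
  proof -
    have c: "K X \<in> carrier_mat (cj + (bj + aj)) (ci + (bi + ai))" "K A \<in> carrier_mat aj ai"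
      "K B \<in> carrier_mat bj bi" "K C \<in> carrier_mat cj ci" "K Y \<in> carrier_mat (bj + aj) (bi + ai)"
      using arrow_Rep[OF _ K] X A B C Y' by auto
    have e: "Fj * K C = K X * Fi" "Gj * K X = K Y * Gi" "fj * K B = K Y * fi" "gj * K Y = K A * gi"
      using I J K unfolding intertwines_def by blast+
    have Z: "K Z = Nj' * (K X * Ni)" unfolding Z_def using car c by (simp add: mat_assoc arrow_map_rep[OF K])
    have 1: "gj * Gj * K X = K A * (gi * Gi)"
    proof -
      have "gj * Gj * K X = gj * (K Y * Gi)" using car c e by (simp add: mat_assoc)
      also have "\<dots> = K A * (gi * Gi)"
        using car c e(4) mat_assoc[of gj "K Y" Gi] by (simp add: mat_assoc)
      finally show ?thesis .
    qed
    \<comment> \<open>The composite to \<open>A\<close> is a morphism that vanishes on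
      \<open>Ni\<close>, so the arrows of \<open>X\<close> map the kernel at \<open>i\<close> into
      the kernel at \<open>j\<close>.\<close>
    have "gj * Gj * (K X * Ni) = K A * (gi * Gi * Ni)"
      using car c mat_assoc[of "gj * Gj" "K X" Ni] 1 by (simp add: mat_assoc)
    also have "\<dots> = 0\<^sub>m aj (ci + bi)" unfolding eqs using c by simp
    finally have 2: "Nj * (Nj' * (K X * Ni)) = K X * Ni"
      using biprod_absorb[OF N2(1), of "K X * Ni" "ci + bi"] car c by (simp add: add.assoc)
    have 3: "(Nj' * Fj) * K C = K Z * (Ni' * Fi)"
      unfolding Z using car c e NF by (simp add: mat_assoc)
    have "(fj' * Gj * Nj) * K Z = fj' * (Gj * (K X * Ni))"
      unfolding Z using car c 2 by (simp add: mat_assoc)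
    also have "\<dots> = fj' * (K Y * (Gi * Ni))"
      using car c e(2) mat_assoc[of Gj "K X" Ni] by (simp add: mat_assoc)
    also have "\<dots> = fj' * (K Y * (fi * (fi' * (Gi * Ni))))" by (simp only: fGN)
    also have "\<dots> = fj' * (fj * (K B * (fi' * (Gi * Ni))))"
      using car c e(3) mat_assoc[of "K Y" fi "fi' * (Gi * Ni)"] mat_assoc[of fj "K B" "fi' * (Gi * Ni)"]
      by simp
    also have "\<dots> = K B * (fi' * (Gi * Ni))"
      using car c by (intro mat_cancel[OF eqs(3)]) auto
    finally show ?thesis using 1 2 3 Z car by (simp add: mat_assoc)
  qed
  have Z: "Z \<in> Rep (ci + bi, cj + bj)"
    unfolding Z_def using arrow_Rep[OF X] car by (intro RepI) (auto simp: arrow_map_rep)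
  have "Z \<in> ext_prod \<B> \<C>"
    by (rule ext_prodI[OF AB(2) YC(2) B C Z N1(2) N2(2)]) (use K in \<open>auto simp: intertwines_def\<close>)
  then show "X \<in> ext_prod \<A> (ext_prod \<B> \<C>)"
    by (rule ext_prodI[OF AB(1) _ A Z _ N1(1) N2(1)]) (use K X in \<open>auto simp: intertwines_def add.assoc\<close>)
qed

section \<open>Duality, associativity and subrepresentations\<close>

abbreviation transpose_rep :: "'a rep \<Rightarrow> 'a rep" where
  "transpose_rep \<equiv> map_rep transpose_mat"

lemma transpose_rep_invol [simp]: "transpose_rep (transpose_rep X) = X"
  by (simp add: map_rep_def)

lemma transpose_rep_Rep: "X \<in> Rep (a, b) \<Longrightarrow> transpose_rep X \<in> Rep (b, a)"
  by (auto simp: Rep_def map_rep_def)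

lemma transpose_rep_image_Rep: "transpose_rep ` Rep (a, b) = (Rep (b, a) :: 'a rep set)"
proof
  show "transpose_rep ` Rep (a, b) \<subseteq> (Rep (b, a) :: 'a rep set)" using transpose_rep_Rep by blast
  show "(Rep (b, a) :: 'a rep set) \<subseteq> transpose_rep ` Rep (a, b)"
  proof
    fix X :: "'a rep" assume "X \<in> Rep (b, a)"
    then have "transpose_rep X \<in> Rep (a, b)" by (rule transpose_rep_Rep)
    then show "X \<in> transpose_rep ` Rep (a, b)" using transpose_rep_invol[of X] by (metis imageI)
  qed
qed

lemma transpose_rep_image_Reps:
  assumes "\<A> \<subseteq> (\<Union>\<alpha>. Rep \<alpha>)"
  shows "transpose_rep ` \<A> \<subseteq> (\<Union>\<alpha>. Rep \<alpha>)"
proof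
  fix X assume "X \<in> transpose_rep ` \<A>"
  then obtain Y where Y: "Y \<in> \<A>" "X = transpose_rep Y" by blast
  then obtain a b where "Y \<in> Rep (a, b)" using assms by fast
  then show "X \<in> (\<Union>\<alpha>. Rep \<alpha>)" using Y transpose_rep_Rep by fast
qed

lemma intertwines_transpose:
  assumes "intertwines X f g Y" "X \<in> Rep (a, b)" "Y \<in> Rep (c, d)"
    "f \<in> carrier_mat c a" "g \<in> carrier_mat d b"
  shows "intertwines (transpose_rep Y) g\<^sup>T f\<^sup>T (transpose_rep X)"
  unfolding intertwines_def
proof
  fix K :: "'a rep \<Rightarrow> 'a mat" assume K: "K \<in> arrows"
  have c: "K X \<in> carrier_mat b a" "K Y \<in> carrier_mat d c" using assms arrow_Rep K by blast+
  have "(K Y * f)\<^sup>T = (g * K X)\<^sup>T" using assms(1) K unfolding intertwines_def by metis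
  then show "f\<^sup>T * K (transpose_rep Y) = K (transpose_rep X) * g\<^sup>T"
    using transpose_mult[OF c(2) assms(4)] transpose_mult[OF assms(5) c(1)]
    by (simp add: arrow_map_rep[OF K])
qed

lemma transpose_ext_prod_subset:
  assumes "(\<A> :: 'a::field_char_0 rep set) \<subseteq> (\<Union>\<alpha>. Rep \<alpha>)" "\<B> \<subseteq> (\<Union>\<alpha>. Rep \<alpha>)"
  shows "transpose_rep ` ext_prod \<A> \<B> \<subseteq> ext_prod (transpose_rep ` \<B>) (transpose_rep ` \<A>)"
proof
  fix X' assume "X' \<in> transpose_rep ` ext_prod \<A> \<B>"
  then obtain X where X': "X' = transpose_rep X" and "X \<in> ext_prod \<A> \<B>" by blast
  then obtain A B a b c d Fi Fi' Gi Gi' Fj Fj' Gj Gj' where AB: "A \<in> \<A>" "B \<in> \<B>"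
    and R: "A \<in> Rep (a, b)" "B \<in> Rep (c, d)" "X \<in> Rep (c + a, d + b)"
    and b: "biprod c a Fi Fi' Gi Gi'" "biprod d b Fj Fj' Gj Gj'"
    and I: "intertwines B Fi Fj X" "intertwines X Gi Gj A"
    using ext_prodE[OF _ assms] by metis
  note bs = b[unfolded biprod_def]
  show "X' \<in> ext_prod (transpose_rep ` \<B>) (transpose_rep ` \<A>)"
    unfolding X'
  proof (rule ext_prodI)
    show "transpose_rep B \<in> Rep (d, c)" "transpose_rep A \<in> Rep (b, a)"
      using R transpose_rep_Rep by blast+
    show "transpose_rep X \<in> Rep (b + d, a + c)"
      using transpose_rep_Rep[OF R(3)] by (simp add: add.commute)
    show "biprod b d Gj\<^sup>T Gj'\<^sup>T Fj\<^sup>T Fj'\<^sup>T" "biprod a c Gi\<^sup>T Gi'\<^sup>T Fi\<^sup>T Fi'\<^sup>T"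
      using b biprod_transpose by blast+
    show "intertwines (transpose_rep A) Gj\<^sup>T Gi\<^sup>T (transpose_rep X)"
      using intertwines_transpose[OF I(2) R(3,1)] bs by blast
    show "intertwines (transpose_rep X) Fj\<^sup>T Fi\<^sup>T (transpose_rep B)"
      using intertwines_transpose[OF I(1) R(2,3)] bs by blast
  qed (use AB in auto)
qed

lemma transpose_ext_prod:
  assumes "(\<A> :: 'a::field_char_0 rep set) \<subseteq> (\<Union>\<alpha>. Rep \<alpha>)" "\<B> \<subseteq> (\<Union>\<alpha>. Rep \<alpha>)"
  shows "transpose_rep ` ext_prod \<A> \<B> = ext_prod (transpose_rep ` \<B>) (transpose_rep ` \<A>)"
proof
  show "transpose_rep ` ext_prod \<A> \<B> \<subseteq> ext_prod (transpose_rep ` \<B>) (transpose_rep ` \<A>)"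
    by (rule transpose_ext_prod_subset[OF assms])
  have "transpose_rep ` ext_prod (transpose_rep ` \<B>) (transpose_rep ` \<A>) \<subseteq> ext_prod \<A> \<B>"
    using transpose_ext_prod_subset[OF transpose_rep_image_Reps[OF assms(2)] transpose_rep_image_Reps[OF assms(1)]]
    by (simp add: image_image)
  then have "transpose_rep ` (transpose_rep ` ext_prod (transpose_rep ` \<B>) (transpose_rep ` \<A>))
    \<subseteq> transpose_rep ` ext_prod \<A> \<B>" by blast
  then show "ext_prod (transpose_rep ` \<B>) (transpose_rep ` \<A>) \<subseteq> transpose_rep ` ext_prod \<A> \<B>"
    by (simp add: image_image)
qed

text \<open>One inclusion is direct; transposition exchanges the two bracketings, so it yields the
  other.\<close>

lemma ext_prod_assoc:
  fixes \<A> :: "'a::field_char_0 rep set"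
  assumes "\<A> \<subseteq> (\<Union>\<alpha>. Rep \<alpha>)" "\<B> \<subseteq> (\<Union>\<alpha>. Rep \<alpha>)" "\<C> \<subseteq> (\<Union>\<alpha>. Rep \<alpha>)"
  shows "ext_prod (ext_prod \<A> \<B>) \<C> = ext_prod \<A> (ext_prod \<B> \<C>)"
proof
  show "ext_prod (ext_prod \<A> \<B>) \<C> \<subseteq> ext_prod \<A> (ext_prod \<B> \<C>)"
    by (rule ext_prod_assoc_subset[OF assms])
  note t = transpose_rep_image_Reps[OF assms(1)] transpose_rep_image_Reps[OF assms(2)]
    transpose_rep_image_Reps[OF assms(3)]
  have "transpose_rep ` ext_prod \<A> (ext_prod \<B> \<C>) \<subseteq> transpose_rep ` ext_prod (ext_prod \<A> \<B>) \<C>"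
    using ext_prod_assoc_subset[OF t(3,2,1)]
    by (simp add: transpose_ext_prod assms ext_prod_Reps)
  then have "transpose_rep ` (transpose_rep ` ext_prod \<A> (ext_prod \<B> \<C>))
     \<subseteq> transpose_rep ` (transpose_rep ` ext_prod (ext_prod \<A> \<B>) \<C>)" by blast
  then show "ext_prod \<A> (ext_prod \<B> \<C>) \<subseteq> ext_prod (ext_prod \<A> \<B>) \<C>"
    by (simp add: image_image)
qed

lemma ext_prod_Rep_assoc:
  "ext_prod (ext_prod (Rep \<alpha>) (Rep \<beta>)) (Rep \<gamma>) =
    ext_prod (Rep \<alpha>) (ext_prod (Rep \<beta>) (Rep \<gamma>) :: 'a::field_char_0 rep set)"
  by (rule ext_prod_assoc) auto

lemma ext_prod_Rep_dual:
  assumes "ext_prod (Rep (a, b)) (Rep (c, d)) = (Rep (e, f) :: 'a::field_char_0 rep set)"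
  shows "ext_prod (Rep (d, c)) (Rep (b, a)) = (Rep (f, e) :: 'a rep set)"
proof -
  have "transpose_rep ` ext_prod (Rep (a, b)) (Rep (c, d)) = (Rep (f, e) :: 'a rep set)"
    unfolding assms by (rule transpose_rep_image_Rep)
  then show ?thesis by (subst (asm) transpose_ext_prod) (auto simp: transpose_rep_image_Rep)
qed

section \<open>Subrepresentations of prescribed dimension vector\<close>

lemma map_rep_Rep:
  "f (fst X) \<in> carrier_mat b a \<Longrightarrow> f (snd X) \<in> carrier_mat b a \<Longrightarrow> map_rep f X \<in> Rep (a, b)"
  by (simp add: map_rep_def Rep_def)

text \<open>The subspaces are the images of \<open>Si\<close> and \<open>Sj\<close>; left inverses
  express injectivity by matrix identities, and \<open>Z\<close> is the arrow induced on the
  subspaces.\<close>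

definition has_subdim :: "nat \<Rightarrow> nat \<Rightarrow> 'a::field rep \<Rightarrow> bool" where
  "has_subdim c d X \<longleftrightarrow> (\<exists>n m Si Si' Sj Sj'. X \<in> Rep (n, m) \<and>
     Si \<in> carrier_mat n c \<and> Si' \<in> carrier_mat c n \<and> Si' * Si = 1\<^sub>m c \<and>
     Sj \<in> carrier_mat m d \<and> Sj' \<in> carrier_mat d m \<and> Sj' * Sj = 1\<^sub>m d \<and>
     (\<forall>K\<in>arrows. \<exists>Z\<in>carrier_mat d c. K X * Si = Sj * Z))"

lemma has_subdimI:
  assumes "X \<in> Rep (n, m)" "Si \<in> carrier_mat n c" "Si' \<in> carrier_mat c n" "Si' * Si = 1\<^sub>m c"
    "Sj \<in> carrier_mat m d" "Sj' \<in> carrier_mat d m" "Sj' * Sj = 1\<^sub>m d"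
    "\<And>K. K \<in> arrows \<Longrightarrow> \<exists>Z\<in>carrier_mat d c. K X * Si = Sj * Z"
  shows "has_subdim c d X"
  unfolding has_subdim_def using assms by blast

lemma has_subdimE:
  assumes "has_subdim c d X" "X \<in> Rep (n, m)"
  obtains Si Si' Sj Sj' Z where
    "Si \<in> carrier_mat n c" "Si' \<in> carrier_mat c n" "Si' * Si = 1\<^sub>m c"
    "Sj \<in> carrier_mat m d" "Sj' \<in> carrier_mat d m" "Sj' * Sj = 1\<^sub>m d"
    "\<forall>K\<in>arrows. Z K \<in> carrier_mat d c \<and> K X * Si = Sj * Z K"
proof -
  obtain n' m' Si Si' Sj Sj' where *: "X \<in> Rep (n', m')"
     "Si \<in> carrier_mat n' c" "Si' \<in> carrier_mat c n'" "Si' * Si = 1\<^sub>m c"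
     "Sj \<in> carrier_mat m' d" "Sj' \<in> carrier_mat d m'" "Sj' * Sj = 1\<^sub>m d"
     "\<forall>K\<in>arrows. \<exists>Z\<in>carrier_mat d c. K X * Si = Sj * Z"
    using assms(1) unfolding has_subdim_def by blast
  have nm: "n' = n" "m' = m" using dimv_Rep[OF *(1)] dimv_Rep[OF assms(2)] by auto
  obtain Z where "\<forall>K\<in>arrows. Z K \<in> carrier_mat d c \<and> K X * Si = Sj * Z K"
    using bchoice[of arrows "\<lambda>K Z. Z \<in> carrier_mat d c \<and> K X * Si = Sj * Z"] *(8) by blast
  then show thesis using that[of Si Si' Sj Sj' Z] *(2-7) unfolding nm by blast
qed

text \<open>Complements of the two subspaces carry the quotient, with arrows
  \<open>Gj * K X * Gi'\<close>. They are compatible with the projections because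
  \<open>Gj * K X\<close> vanishes on \<open>Si\<close>.\<close>

lemma ext_prod_of_has_subdim:
  assumes "has_subdim c d X" "(X :: 'a::field_char_0 rep) \<in> Rep (n, m)"
  shows "c \<le> n" "d \<le> m" "X \<in> ext_prod (Rep (n - c, m - d)) (Rep (c, d))"
proof -
  obtain Si Si' Sj Sj' Z where S: "Si \<in> carrier_mat n c" "Si' \<in> carrier_mat c n" "Si' * Si = 1\<^sub>m c"
    "Sj \<in> carrier_mat m d" "Sj' \<in> carrier_mat d m" "Sj' * Sj = 1\<^sub>m d"
    and Z': "\<forall>K\<in>arrows. Z K \<in> carrier_mat d c \<and> K X * Si = Sj * Z K"
    using has_subdimE[OF assms] .
  note Z = Z'[rule_format]
  obtain a Gi Gi' where a: "n = c + a" "biprod c a Si Si' Gi Gi'"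
    using biprod_complete_mono[OF S(1-3)] .
  obtain b Gj Gj' where b: "m = d + b" "biprod d b Sj Sj' Gj Gj'"
    using biprod_complete_mono[OF S(4-6)] .
  have bs: "Si \<in> carrier_mat (c + a) c" "Si' \<in> carrier_mat c (c + a)"
    "Gi \<in> carrier_mat a (c + a)" "Gi' \<in> carrier_mat (c + a) a"
    "Sj \<in> carrier_mat (d + b) d" "Sj' \<in> carrier_mat d (d + b)"
    "Gj \<in> carrier_mat b (d + b)" "Gj' \<in> carrier_mat (d + b) b"
    "Sj' * Sj = 1\<^sub>m d" "Gj * Sj = 0\<^sub>m b d"
    using a(2) b(2) by (auto simp: biprod_def)
  show "c \<le> n" "d \<le> m" using a b by auto
  define A where "A = map_rep (\<lambda>M. Gj * M * Gi') X"
  define B where "B = map_rep (\<lambda>M. Sj' * M * Si) X"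
  have X: "X \<in> Rep (c + a, d + b)" using assms a b by simp
  have A: "A \<in> Rep (a, b)" unfolding A_def
    using arrow_Rep[OF X, of fst] arrow_Rep[OF X, of snd] bs by (intro map_rep_Rep) auto
  have B: "B \<in> Rep (c, d)" unfolding B_def
    using arrow_Rep[OF X, of fst] arrow_Rep[OF X, of snd] bs by (intro map_rep_Rep) auto
  have K: "Sj * K B = K X * Si \<and> Gj * K X = K A * Gi" if K: "K \<in> arrows" for K
  proof
    have KX: "K X \<in> carrier_mat (d + b) (c + a)" using arrow_Rep[OF X K] .
    have KB: "K B = Sj' * (Sj * Z K)"
      using KX bs Z[OF K] by (simp add: B_def mat_assoc arrow_map_rep[OF K])
    also have "\<dots> = Z K" using Z[OF K] bs by (intro mat_cancel) auto
    finally show "Sj * K B = K X * Si" using Z[OF K] by simp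
    have "(Gj * K X) * Si = Gj * (Sj * Z K)" using KX bs Z[OF K] by (simp add: mat_assoc)
    also have "\<dots> = 0\<^sub>m b c" using mat_cancel_zero[of Gj Sj b d "Z K"] bs Z[OF K] by auto
    finally have "(Gj * K X) * (Gi' * Gi) = Gj * K X"
      using KX bs by (intro biprod_absorb'[OF a(2), of _ b]) auto
    then show "Gj * K X = K A * Gi"
      using KX bs by (simp add: A_def mat_assoc arrow_map_rep[OF K])
  qed
  have "X \<in> ext_prod (Rep (a, b)) (Rep (c, d))"
    by (rule ext_prodI[OF A B A B X a(2) b(2)]) (use K in \<open>auto simp: intertwines_def\<close>)
  then show "X \<in> ext_prod (Rep (n - c, m - d)) (Rep (c, d))" using a b by simp
qed

lemma has_subdim_of_ext_prod:
  assumes "(X :: 'a::field_char_0 rep) \<in> ext_prod (Rep \<alpha>) (Rep (c, d))"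
  shows "has_subdim c d X"
proof -
  have "Rep \<alpha> \<subseteq> (\<Union>\<alpha>. Rep \<alpha> :: 'a rep set)" "Rep (c, d) \<subseteq> (\<Union>\<alpha>. Rep \<alpha> :: 'a rep set)"
    by auto
  from ext_prodE[OF assms this]
  obtain A B a b c' d' Fi Fi' Gi Gi' Fj Fj' Gj Gj' where
    R: "B \<in> Rep (c, d)" "B \<in> Rep (c', d')" "X \<in> Rep (c' + a, d' + b)"
    and b: "biprod c' a Fi Fi' Gi Gi'" "biprod d' b Fj Fj' Gj Gj'"
    and I: "intertwines B Fi Fj X" by metis
  have cd: "c' = c" "d' = d" using dimv_Rep[OF R(1)] dimv_Rep[OF R(2)] by auto
  note bs = b[unfolded biprod_def cd]
  show ?thesis
  proof (rule has_subdimI[OF R(3), of Fi c Fi' Fj d Fj'])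
    fix K :: "'a rep \<Rightarrow> 'a mat" assume K: "K \<in> arrows"
    show "\<exists>Z\<in>carrier_mat d c. K X * Fi = Fj * Z"
      using I K arrow_Rep[OF R(1) K] by (intro bexI[of _ "K B"]) (auto simp: intertwines_def)
  qed (use bs in \<open>auto simp: cd\<close>)
qed

lemma ext_prod_Rep_eqI:
  assumes "\<And>X. (X :: 'a::field_char_0 rep) \<in> Rep (a + c, b + d) \<Longrightarrow> has_subdim c d X"
  shows "ext_prod (Rep (a, b)) (Rep (c, d)) = (Rep (a + c, b + d) :: 'a rep set)"
proof
  show "ext_prod (Rep (a, b)) (Rep (c, d)) \<subseteq> (Rep (a + c, b + d) :: 'a rep set)"
    using ext_prod_Rep_subset[of "(a, b)" "(c, d)"] by simp
  show "(Rep (a + c, b + d) :: 'a rep set) \<subseteq> ext_prod (Rep (a, b)) (Rep (c, d))"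
    using ext_prod_of_has_subdim(3)[OF assms] by fastforce
qed

text \<open>Any \<open>c\<close>-dimensional subspace at \<open>i\<close> together with the whole
  space at \<open>j\<close> is a subrepresentation.\<close>

lemma ext_prod_Rep_source:
  "ext_prod (Rep (a, 0)) (Rep (c, d)) = (Rep (a + c, d) :: 'a::field_char_0 rep set)"
proof -
  have "has_subdim c d X" if X: "X \<in> Rep (a + c, 0 + d)" for X :: "'a rep"
  proof (rule has_subdimI[OF X, of "delta_mat (a + c) c" c "delta_mat c (a + c)" "1\<^sub>m d" d "1\<^sub>m d"])
    fix K :: "'a rep \<Rightarrow> 'a mat" assume K: "K \<in> arrows"
    show "\<exists>Z\<in>carrier_mat d c. K X * delta_mat (a + c) c = 1\<^sub>m d * Z"
      using arrow_Rep[OF X K] by (intro bexI[of _ "K X * delta_mat (a + c) c"]) auto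
  qed (simp_all add: delta_mat_mult)
  from ext_prod_Rep_eqI[of a c 0 d, OF this] show ?thesis by simp
qed

lemma ext_prod_Rep_sink:
  "ext_prod (Rep (a, b)) (Rep (0, d)) = (Rep (a, b + d) :: 'a::field_char_0 rep set)"
  using ext_prod_Rep_dual[OF ext_prod_Rep_source[of d b a]] by (simp add: add.commute)

section \<open>Subrepresentations of dimension (1, 1)\<close>

lemma has_subdim_vec:
  assumes X: "(X :: 'a::field rep) \<in> Rep (n, m)" and v: "v \<in> carrier_vec n" "v \<noteq> 0\<^sub>v n"
    and w: "w \<in> carrier_vec m" "w \<noteq> 0\<^sub>v m"
    and Xv: "fst X *\<^sub>v v = s \<cdot>\<^sub>v w" "snd X *\<^sub>v v = t \<cdot>\<^sub>v w"
  shows "has_subdim 1 1 X"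
proof -
  define M :: "nat \<Rightarrow> 'a vec \<Rightarrow> 'a mat" where "M n v = mat n 1 (\<lambda>(i, j). v $ i)" for n v
  have L: "\<exists>S'\<in>carrier_mat 1 n. S' * M n v = 1\<^sub>m 1" if "v \<in> carrier_vec n" "v \<noteq> 0\<^sub>v n" for n v
  proof -
    have "\<exists>i0<n. v $ i0 \<noteq> 0"
    proof (rule ccontr)
      assume "\<not> ?thesis"
      then have "v = 0\<^sub>v n" using that(1) by (intro eq_vecI) auto
      then show False using that(2) by simp
    qed
    then obtain i0 where "i0 < n" "v $ i0 \<noteq> 0" by blast
    then have "mat 1 n (\<lambda>(_, j). if j = i0 then 1 / v $ i0 else 0) * M n v = 1\<^sub>m 1"
      by (intro eq_matI) (auto simp: M_def scalar_prod_def if_distrib[of "\<lambda>x. x * _"] cong: if_cong)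
    then show ?thesis by (meson mat_carrier)
  qed
  obtain Si' Sj' where S: "Si' \<in> carrier_mat 1 n" "Si' * M n v = 1\<^sub>m 1"
    "Sj' \<in> carrier_mat 1 m" "Sj' * M m w = 1\<^sub>m 1"
    using L[OF v] L[OF w] by blast
  have E: "Y * M n v = M m w * mat 1 1 (\<lambda>_. r)"
    if "Y \<in> carrier_mat m n" "Y *\<^sub>v v = r \<cdot>\<^sub>v w" for Y r
  proof (rule eq_matI)
    fix i j assume "i < dim_row (M m w * mat 1 1 (\<lambda>_. r))" "j < dim_col (M m w * mat 1 1 (\<lambda>_. r))"
    then have ij: "i < m" "j = 0" by (auto simp: M_def)
    have "row Y i \<bullet> v = (Y *\<^sub>v v) $ i" using that(1) ij by simp
    also have "\<dots> = r * w $ i" unfolding that(2) using ij w by simp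
    finally show "(Y * M n v) $$ (i, j) = (M m w * mat 1 1 (\<lambda>_. r)) $$ (i, j)"
      using ij that(1) v by (simp add: M_def scalar_prod_def mult.commute)
  qed (use that in \<open>auto simp: M_def\<close>)
  show ?thesis
  proof (rule has_subdimI[OF X _ S(1,2) _ S(3,4)])
    fix K :: "'a rep \<Rightarrow> 'a mat" assume K: "K \<in> arrows"
    then obtain r where "K X *\<^sub>v v = r \<cdot>\<^sub>v w" using Xv by blast
    then show "\<exists>Z\<in>carrier_mat 1 1. K X * M n v = M m w * Z"
      using E[OF arrow_Rep[OF X K], of r] by (intro bexI[of _ "mat 1 1 (\<lambda>_. r)"]) auto
  qed (auto simp: M_def)
qed

text \<open>If both arrows kill \<open>v\<close>, any nonzero vector at \<open>j\<close> completes
  it; the dimension \<open>Suc m\<close> provides one.\<close>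

lemma has_subdim_kernel:
  assumes X: "(X :: 'a::field rep) \<in> Rep (n, Suc m)" and v: "v \<in> carrier_vec n" "v \<noteq> 0\<^sub>v n"
    and Xv: "fst X *\<^sub>v v = 0\<^sub>v (Suc m)"
  shows "has_subdim 1 1 X"
proof (cases "snd X *\<^sub>v v = 0\<^sub>v (Suc m)")
  case True
  have u: "unit_vec (Suc m) 0 \<noteq> (0\<^sub>v (Suc m) :: 'a vec)" by (simp add: unit_vec_nonzero)
  have "0 \<cdot>\<^sub>v unit_vec (Suc m) 0 = (0\<^sub>v (Suc m) :: 'a vec)" by (intro eq_vecI) auto
  then show ?thesis using has_subdim_vec[OF X v _ u, of 0 0] Xv True by simp
next
  case False
  have c: "snd X *\<^sub>v v \<in> carrier_vec (Suc m)"
    using X by (auto simp: Rep_def intro!: carrier_vecI)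
  have "0 \<cdot>\<^sub>v (snd X *\<^sub>v v) = 0\<^sub>v (Suc m)"
    using arrow_Rep[OF X, of snd] by (intro eq_vecI) auto
  then show ?thesis using has_subdim_vec[OF X v c False, of 0 1] Xv by simp
qed

text \<open>The first arrow has more columns than rows, hence a kernel vector. Read as
  \<open>I(m) * \<delta>_1 = I(m + 1)\<close>, the relation lets adjacent factors exchange a
  \<open>\<delta>_1\<close>.\<close>

lemma ext_prod_preinj_regular:
  "ext_prod (Rep (m + 1, m)) (Rep (1, 1)) = (Rep (m + 2, m + 1) :: 'a::field_char_0 rep set)"
proof -
  have "has_subdim 1 1 X" if X: "X \<in> Rep (m + 1 + 1, m + 1)" for X :: "'a rep"
  proof -
    have "fst X \<in> carrier_mat (m + 1) (m + 1 + 1)" using arrow_Rep[OF X] by simp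
    then obtain v where "v \<in> carrier_vec (m + 1 + 1)" "v \<noteq> 0\<^sub>v (m + 1 + 1)" "fst X *\<^sub>v v = 0\<^sub>v (m + 1)"
      using kernel_nontrivial by (metis less_add_one)
    then show ?thesis using has_subdim_kernel X by (metis Suc_eq_plus1)
  qed
  from ext_prod_Rep_eqI[of "m + 1" 1 m 1, OF this] show ?thesis by simp
qed

lemma ext_prod_regular_preproj:
  "ext_prod (Rep (1, 1)) (Rep (m, m + 1)) = (Rep (m + 1, m + 2) :: 'a::field_char_0 rep set)"
  by (rule ext_prod_Rep_dual[OF ext_prod_preinj_regular])

lemma ext_prod_regular_one:
  "ext_prod (Rep (n, n)) (Rep (1, 1)) =
    (Rep (n + 1, n + 1) :: 'a::{alg_closed_field, field_char_0} rep set)"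
proof -
  have "has_subdim 1 1 X" if X: "X \<in> Rep (n + 1, n + 1)" for X :: "'a rep"
  proof -
    have A: "fst X \<in> carrier_mat (n + 1) (n + 1)" and B: "snd X \<in> carrier_mat (n + 1) (n + 1)"
      using arrow_Rep[OF X, of fst] arrow_Rep[OF X, of snd] by simp_all
    show ?thesis
    proof (cases "det (fst X) = 0")
      case True
      then obtain v where "v \<in> carrier_vec (n + 1)" "v \<noteq> 0\<^sub>v (n + 1)" "fst X *\<^sub>v v = 0\<^sub>v (n + 1)"
        using det_0_iff_vec_prod_zero[OF A] by blast
      then show ?thesis using has_subdim_kernel X by (metis Suc_eq_plus1)
    next
      case False
      from det_non_zero_imp_unit[OF A this, of "()"]
      obtain C where C: "C \<in> carrier_mat (n + 1) (n + 1)" "fst X * C = 1\<^sub>m (n + 1)"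
        unfolding Units_def ring_mat_def by auto
      have CB: "C * snd X \<in> carrier_mat (n + 1) (n + 1)" using C B by simp
      have "degree (char_poly (C * snd X)) > 0" using degree_monic_char_poly[OF CB] by simp
      \<comment> \<open>Algebraic closedness enters here. As \<open>C\<close> inverts the first
        arrow, an eigenvector \<open>v\<close> of \<open>C * snd X\<close> is mapped by both arrows
        into the line of \<open>w = fst X *\<^sub>v v\<close>.\<close>
      then obtain k where "poly (char_poly (C * snd X)) k = 0" using alg_closed_imp_poly_has_root by blast
      then obtain v where v: "v \<in> carrier_vec (n + 1)" "v \<noteq> 0\<^sub>v (n + 1)" "(C * snd X) *\<^sub>v v = k \<cdot>\<^sub>v v"
        using eigenvalue_root_char_poly[OF CB] C(1) unfolding eigenvalue_def eigenvector_def by auto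
      define w where "w = fst X *\<^sub>v v"
      have w: "w \<in> carrier_vec (n + 1)" using A by (auto simp: w_def intro!: carrier_vecI)
      have w0: "w \<noteq> 0\<^sub>v (n + 1)" using False v det_0_iff_vec_prod_zero[OF A] unfolding w_def by blast
      have "snd X *\<^sub>v v = (fst X * C * snd X) *\<^sub>v v" using C B by simp
      also have "\<dots> = fst X *\<^sub>v ((C * snd X) *\<^sub>v v)"
        using A B C v mat_assoc[of "fst X" C "snd X"] assoc_mult_mat_vec[OF A CB v(1)] by simp
      also have "\<dots> = k \<cdot>\<^sub>v w" unfolding v(3) w_def by (rule mult_mat_vec[OF A v(1)])
      finally show ?thesis using has_subdim_vec[OF X v(1,2) w w0, of 1 k] w by (simp add: w_def)
    qed
  qed
  from ext_prod_Rep_eqI[of n 1 n 1, OF this] show ?thesis by simp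
qed

section \<open>Products of preinjective and of preprojective dimension vectors\<close>

lemma mult_mat_zero_vec: "(A :: 'a::semiring_0 mat) \<in> carrier_mat n m \<Longrightarrow> A *\<^sub>v 0\<^sub>v m = 0\<^sub>v n"
  by (rule eq_vecI) auto

lemma preinj_Rep: "preinj n \<in> Rep (n + 1, n)"
  by (simp add: preinj_def Rep_def)

lemma mult_preinj:
  assumes Y: "(Y :: 'a::field mat) \<in> carrier_mat p n" and "i < p" "l \<le> n"
  shows "(Y * fst (preinj n)) $$ (i, l) = (if l < n then Y $$ (i, l) else 0)"
    and "(Y * snd (preinj n)) $$ (i, l) = (case l of 0 \<Rightarrow> 0 | Suc k \<Rightarrow> Y $$ (i, k))"
proof -
  show "(Y * fst (preinj n)) $$ (i, l) = (if l < n then Y $$ (i, l) else 0)"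
    using assms by (auto simp: preinj_def scalar_prod_def if_distrib[of "\<lambda>x. _ * x"] cong: if_cong)
  show "(Y * snd (preinj n)) $$ (i, l) = (case l of 0 \<Rightarrow> 0 | Suc k \<Rightarrow> Y $$ (i, k))"
    using assms by (cases l)
      (auto simp: preinj_def scalar_prod_def if_distrib[of "\<lambda>x. _ * x"] cong: if_cong)
qed

text \<open>With columns \<open>v_0, ..., v_n\<close> of \<open>V\<close>, a morphism amounts to
  \<open>snd X v_k = fst X v_(k - 1)\<close> for \<open>0 \<le> k \<le> n + 1\<close>, where
  \<open>v_(-1) = v_(n + 1) = 0\<close>. These are \<open>(n + 2) p\<close> equations in
  \<open>(n + 1) (p + 2)\<close> unknowns, and the difference \<open>2 n + 2 - p\<close> is
  positive.\<close>

lemma nonzero_hom_from_preinj: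
  assumes X: "(X :: 'a::field rep) \<in> Rep (p + 2, p)" and p: "p \<le> 2 * n + 1"
  obtains V Y where "V \<in> carrier_mat (p + 2) (n + 1)" "Y \<in> carrier_mat p n"
    "V \<noteq> 0\<^sub>m (p + 2) (n + 1)" "intertwines (preinj n) V Y X"
proof -
  define I where "I = {..n} \<times> {..<p + 2}"
  define J where "J = {..n + 1} \<times> {..<p}"
  \<comment> \<open>Row \<open>i\<close> of equation \<open>k\<close>: \<open>snd X\<close> acts on
    column \<open>k\<close> and \<open>fst X\<close> on column \<open>k - 1\<close>.\<close>
  define a where "a = (\<lambda>(k, i) (l, j).
    (if l = k then snd X $$ (i, j) else 0) - (if Suc l = k then fst X $$ (i, j) else 0))"
  have "card J < card I" unfolding I_def J_def using p by (simp add: algebra_simps)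
  then obtain x where x: "\<exists>i\<in>I. x i \<noteq> 0" "\<forall>j\<in>J. (\<Sum>i\<in>I. a j i * x i) = 0"
    using homogeneous_system[of J I a] by (auto simp: I_def J_def)
  have A: "fst X \<in> carrier_mat p (p + 2)" and B: "snd X \<in> carrier_mat p (p + 2)"
    using arrow_Rep[OF X, of fst] arrow_Rep[OF X, of snd] by simp_all
  define V where "V = mat (p + 2) (n + 1) (\<lambda>(j, l). x (l, j))"
  \<comment> \<open>The first arrow of \<open>preinj n\<close> sends the first \<open>n\<close>
    basis vectors to the basis at \<open>j\<close>, so \<open>V\<close> determines
    \<open>Y\<close>.\<close>
  define Y where "Y = mat p n (\<lambda>(i, l). (fst X * V) $$ (i, l))"
  have V: "V \<in> carrier_mat (p + 2) (n + 1)" and Y: "Y \<in> carrier_mat p n"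
    by (simp_all add: V_def Y_def)
  have E: "(M * V) $$ (i, l) = (\<Sum>j<p + 2. M $$ (i, j) * x (l, j))"
    if "M \<in> carrier_mat p (p + 2)" "i < p" "l \<le> n" for M i l
    using that by (simp add: V_def scalar_prod_def lessThan_atLeast0)
  have S: "(\<Sum>l\<le>n. if l = k then (snd X * V) $$ (i, l) else 0) =
      (\<Sum>l\<le>n. if Suc l = k then (fst X * V) $$ (i, l) else 0)"
    if "k \<le> n + 1" "i < p" for k i
  proof -
    have "0 = (\<Sum>q\<in>I. a (k, i) q * x q)" using x(2) that by (auto simp: J_def)
    also have "\<dots> = (\<Sum>l\<le>n. \<Sum>j<p + 2. a (k, i) (l, j) * x (l, j))"
      unfolding I_def by (subst sum.cartesian_product) (simp add: case_prod_unfold)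
    also have "\<dots> = (\<Sum>l\<le>n. (if l = k then (snd X * V) $$ (i, l) else 0) -
        (if Suc l = k then (fst X * V) $$ (i, l) else 0))"
    proof (rule sum.cong)
      fix l assume l: "l \<in> {..n}"
      show "(\<Sum>j<p + 2. a (k, i) (l, j) * x (l, j)) =
        (if l = k then (snd X * V) $$ (i, l) else 0) - (if Suc l = k then (fst X * V) $$ (i, l) else 0)"
        using E[OF A that(2), of l] E[OF B that(2), of l] l
        by (auto simp: a_def left_diff_distrib sum_subtractf sum_negf simp del: sum.lessThan_Suc)
    qed simp
    finally show ?thesis by (simp add: sum_subtractf)
  qed
  have B0: "(snd X * V) $$ (i, 0) = 0" if "i < p" for i
    using S[of 0 i] that by simp
  have BA: "(snd X * V) $$ (i, Suc k) = (fst X * V) $$ (i, k)" if "i < p" "k < n" for i k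
    using S[of "Suc k" i] that by simp
  have An: "(fst X * V) $$ (i, n) = 0" if "i < p" for i
    using S[of "Suc n" i] that by simp
  have 1: "Y * fst (preinj n) = fst X * V"
  proof (rule eq_matI)
    fix i l assume "i < dim_row (fst X * V)" "l < dim_col (fst X * V)"
    then have il: "i < p" "l \<le> n" using A V by auto
    then show "(Y * fst (preinj n)) $$ (i, l) = (fst X * V) $$ (i, l)"
      unfolding mult_preinj(1)[OF Y il] using An[of i] by (cases "l = n") (auto simp: Y_def)
  qed (use A V Y preinj_Rep[of n, where ?'a = 'a] in \<open>auto simp: Rep_def\<close>)
  have 2: "Y * snd (preinj n) = snd X * V"
  proof (rule eq_matI)
    fix i l assume "i < dim_row (snd X * V)" "l < dim_col (snd X * V)"
    then have il: "i < p" "l \<le> n" using B V by auto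
    then show "(Y * snd (preinj n)) $$ (i, l) = (snd X * V) $$ (i, l)"
      unfolding mult_preinj(2)[OF Y il] using B0[of i] BA[of i] by (cases l) (auto simp: Y_def)
  qed (use B V Y preinj_Rep[of n, where ?'a = 'a] in \<open>auto simp: Rep_def\<close>)
  have "V \<noteq> 0\<^sub>m (p + 2) (n + 1)"
  proof -
    obtain l j where "l \<le> n" "j < p + 2" "x (l, j) \<noteq> 0" using x(1) by (auto simp: I_def)
    then have "V $$ (j, l) \<noteq> (0\<^sub>m (p + 2) (n + 1) :: 'a mat) $$ (j, l)" by (simp add: V_def)
    then show ?thesis by metis
  qed
  then show thesis using that[OF V Y] 1 2 by (auto simp: intertwines_def)
qed

lemma left_inv_dim_le:
  assumes "(S :: 'a::field_char_0 mat) \<in> carrier_mat n c" "S' \<in> carrier_mat c n" "S' * S = 1\<^sub>m c"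
  shows "c \<le> n"
  using biprod_complete_mono[OF assms] by (metis le_add1)

text \<open>
  The image of a nonzero map from a preinjective indecomposable has more dimension at the source
  than at the sink, since \<open>snd X\<close> maps its source part onto its sink part with nonzero kernel.
\<close>

lemma has_subdim_image_preinj:
  assumes X: "(X :: 'a::field_char_0 rep) \<in> Rep (a, p)"
    and V: "V \<in> carrier_mat a (n + 1)" and Y: "Y \<in> carrier_mat p n"
    and V0: "V \<noteq> 0\<^sub>m a (n + 1)" and I: "intertwines (preinj n) V Y X"
  obtains e f where "has_subdim e f X" "f < e" "e \<le> n + 1"
proof -
  obtain e S S' T T' where S: "S \<in> carrier_mat a e" "S' \<in> carrier_mat e a" "T \<in> carrier_mat e (n + 1)"
    "T' \<in> carrier_mat (n + 1) e" "V = S * T" "S' * S = 1\<^sub>m e" "T * T' = 1\<^sub>m e"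
    using rank_factorization[OF V] .
  obtain f Q Q' R R' where Q: "Q \<in> carrier_mat p f" "Q' \<in> carrier_mat f p" "R \<in> carrier_mat f n"
    "R' \<in> carrier_mat n f" "Y = Q * R" "Q' * Q = 1\<^sub>m f" "R * R' = 1\<^sub>m f"
    using rank_factorization[OF Y] .
  have D: "K (preinj n) \<in> carrier_mat n (n + 1)" if "K \<in> arrows" for K :: "'a rep \<Rightarrow> 'a mat"
    using arrow_Rep[OF preinj_Rep that] by simp
  have XV: "Y * K (preinj n) = K X * V" if "K \<in> arrows" for K
    using I that unfolding intertwines_def by blast
  have sub: "has_subdim e f X"
  proof (rule has_subdimI[OF X S(1,2,6) Q(1,2,6)])
    fix K :: "'a rep \<Rightarrow> 'a mat" assume K: "K \<in> arrows"
    have c: "K X \<in> carrier_mat p a" using arrow_Rep[OF X K] .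
    have "K X * S = K X * (S * (T * T'))" using S by simp
    also have "\<dots> = (K X * V) * T'" using S(1-4) c unfolding S(5) by (simp add: mat_assoc)
    also have "\<dots> = Q * (R * K (preinj n) * T')"
      unfolding XV[OF K, symmetric] Q(5) using Q(1-4) D[OF K] S(4) by (simp add: mat_assoc)
    finally show "\<exists>Z\<in>carrier_mat f e. K X * S = Q * Z"
      using Q(3) D[OF K] S(4) by (intro bexI[of _ "R * K (preinj n) * T'"]) auto
  qed
  have e: "e \<le> n + 1"
    using left_inv_dim_le[of "T\<^sup>T" "n + 1" e "T'\<^sup>T"] S(3,4,7) transpose_mult[OF S(3,4)] by simp
  define B where "B = snd X"
  define D1 where "D1 = (snd (preinj n) :: 'a mat)"
  have B: "B \<in> carrier_mat p a" and D1: "D1 \<in> carrier_mat n (n + 1)"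
    using arrow_Rep[OF X, of snd] D[of snd] by (simp_all add: B_def D1_def)
  have BV: "B * V = Y * D1" using XV[of snd] by (simp add: B_def D1_def)
  \<comment> \<open>The second arrow induced on the image. From \<open>W * T = R * D1\<close>, with
    \<open>R\<close> and \<open>D1\<close> right invertible, it is surjective, with right inverse
    \<open>U\<close>.\<close>
  define W where "W = Q' * B * S"
  have W: "W \<in> carrier_mat f e" using Q S B by (auto simp: W_def)
  have WT: "W * T = Q' * (B * V)" unfolding W_def S(5) using Q(1,2) S(1-4) B by (simp add: mat_assoc)
  also have "\<dots> = Q' * (Q * (R * D1))" unfolding BV Q(5) using Q(1-4) D1 by (simp add: mat_assoc)
  also have "\<dots> = R * D1" using Q D1 by (intro mat_cancel) auto
  finally have WTR: "W * T = R * D1" .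
  define U where "U = T * (D1\<^sup>T * R')"
  have U: "U \<in> carrier_mat e f" using S Q D1 by (auto simp: U_def)
  have DD: "D1 * D1\<^sup>T = 1\<^sub>m n"
    by (rule eq_matI)
      (auto simp: D1_def preinj_def scalar_prod_def if_distrib[of "\<lambda>x. x * _"] cong: if_cong)
  have "W * U = (W * T) * (D1\<^sup>T * R')"
    unfolding U_def using W S(3) D1 Q(4) by (simp add: mat_assoc)
  also have "\<dots> = R * (D1 * (D1\<^sup>T * R'))" unfolding WTR using D1 Q(3,4) by (simp add: mat_assoc)
  also have "\<dots> = 1\<^sub>m f" using mat_cancel[OF DD, of R'] D1 Q(4,7) by simp
  finally have WU: "W * U = 1\<^sub>m f" .
  have fe: "f \<le> e" using left_inv_dim_le[OF U W WU] .
  have "f \<noteq> e"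
  proof
    assume "f = e"
    then have UW: "U * W = 1\<^sub>m e" using mat_mult_left_right_inverse[of W e U] W U WU by simp
    \<comment> \<open>If \<open>W\<close> is bijective, \<open>M\<close> recovers \<open>V\<close>
      from \<open>B * V\<close>. The first column of \<open>B * V\<close> is zero and each later one
      equals the preceding column of \<open>fst X * V\<close>, so the columns of \<open>V\<close>
      vanish one by one.\<close>
    define M where "M = S * (U * Q')"
    have M: "M \<in> carrier_mat a p" using S U Q by (auto simp: M_def)
    note M0 = mult_mat_zero_vec[OF M]
    have "M * (B * V) = S * (U * (W * T))"
      unfolding WT M_def using S(1) U Q(2) B V by (simp add: mat_assoc)
    also have "\<dots> = V" using mat_cancel[OF UW, of T] U W S(3,5) by simp
    finally have MV: "M * (B * V) = V" .
    have "col V l = 0\<^sub>v a" if "l \<le> n" for l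
      using that
    proof (induction l)
      case 0
      have "col (B * V) 0 = 0\<^sub>v p"
        unfolding BV using Y D1 mult_preinj(2)[OF Y, of _ 0] by (intro eq_vecI) (auto simp: D1_def)
      then have "col (M * (B * V)) 0 = M *\<^sub>v 0\<^sub>v p"
        using col_mult2[OF M, of "B * V" "n + 1" 0] B V by simp
      then show ?case by (simp add: MV M0)
    next
      case (Suc l)
      have "col (fst X * V) l = fst X *\<^sub>v col V l"
        using col_mult2[of "fst X" p a V "n + 1" l] arrow_Rep[OF X, of fst] V Suc.prems by simp
      also have "\<dots> = 0\<^sub>v p" using Suc mult_mat_zero_vec[OF arrow_Rep[OF X, of fst]] by simp
      finally have A0: "col (Y * fst (preinj n)) l = 0\<^sub>v p" using XV[of fst] by simp
      have "Y $$ (i, l) = 0" if "i < p" for i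
      proof -
        have "(Y * fst (preinj n)) $$ (i, l) = col (Y * fst (preinj n)) l $ i"
          using that Suc.prems Y D[of fst] by simp
        then show ?thesis using A0 that mult_preinj(1)[OF Y that, of l] Suc.prems by simp
      qed
      then have "col (B * V) (Suc l) = 0\<^sub>v p"
        unfolding BV using Y D1 mult_preinj(2)[OF Y, of _ "Suc l"] Suc.prems
        by (intro eq_vecI) (auto simp: D1_def)
      then have "col (M * (B * V)) (Suc l) = M *\<^sub>v 0\<^sub>v p"
        using col_mult2[OF M, of "B * V" "n + 1" "Suc l"] B V Suc.prems by simp
      then show ?case by (simp add: MV M0)
    qed
    then have "V = 0\<^sub>m a (n + 1)" using V by (intro mat_col_eqI) auto
    then show False using V0 by simp
  qed
  then show thesis using that[OF sub _ e] fe by simp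
qed

text \<open>Writing \<open>I(m + 1) = I(m) * \<delta>_1\<close>, the factor
  \<open>\<delta>_1\<close> is absorbed by its right neighbour, because
  \<open>\<delta>_1 * I(q)\<close> lies in \<open>Rep (q + 2, q + 1)\<close>.\<close>

lemma ext_prod_preinj_step:
  "ext_prod (Rep (m + 2, m + 1)) (Rep (q + 1, q)) \<subseteq>
    (ext_prod (Rep (m + 1, m)) (Rep (q + 2, q + 1)) :: 'a::field_char_0 rep set)"
proof -
  have "ext_prod (Rep (1, 1)) (Rep (q + 1, q)) \<subseteq> (Rep (q + 2, q + 1) :: 'a rep set)"
    using ext_prod_Rep_subset[of "(1, 1)" "(q + 1, q)"] by (simp add: eval_nat_numeral)
  moreover have "ext_prod (Rep (m + 2, m + 1)) (Rep (q + 1, q)) =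
      ext_prod (Rep (m + 1, m)) (ext_prod (Rep (1, 1)) (Rep (q + 1, q)) :: 'a rep set)"
    unfolding ext_prod_preinj_regular[of m, symmetric] by (rule ext_prod_Rep_assoc)
  ultimately show ?thesis by (simp add: ext_prod_mono)
qed

lemma ext_prod_preinj_balance:
  assumes "q \<le> n" "n \<le> p"
  shows "ext_prod (Rep (p - q + 1, p - q)) (Rep (q + 1, q)) \<subseteq>
    (ext_prod (Rep (p - n + 1, p - n)) (Rep (n + 1, n)) :: 'a::field_char_0 rep set)"
  using assms
proof (induction n rule: dec_induct)
  case (step n)
  have "p - n = Suc (p - Suc n)" using step by simp
  then show ?case
    using step ext_prod_preinj_step[of "p - Suc n" n, where ?'a = 'a] by (simp add: eval_nat_numeral)
qed simp

lemma ext_prod_preinj_preinj: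
  assumes "m \<le> n + 1"
  shows "ext_prod (Rep (m + 1, m)) (Rep (n + 1, n)) = (Rep (m + n + 2, m + n) :: 'a::field_char_0 rep set)"
proof -
  define p where "p = m + n"
  have np: "n \<le> p" and mp: "m = p - n" and p: "p \<le> 2 * n + 1" using assms by (auto simp: p_def)
  have "X \<in> ext_prod (Rep (p - n + 1, p - n)) (Rep (n + 1, n))" if X: "X \<in> Rep (p + 2, p)" for X :: "'a rep"
  proof -
    obtain V Y where "V \<in> carrier_mat (p + 2) (n + 1)" "Y \<in> carrier_mat p n"
      "V \<noteq> 0\<^sub>m (p + 2) (n + 1)" "intertwines (preinj n) V Y X"
      using nonzero_hom_from_preinj[OF X p] .
    then obtain e f where ef: "has_subdim e f X" "f < e" "e \<le> n + 1"
      using has_subdim_image_preinj[OF X] by metis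
    define q where "q = e - 1"
    have q: "e = q + 1" "q \<le> n" "f \<le> q" using ef by (auto simp: q_def)
    have "X \<in> ext_prod (Rep (p + 2 - e, p - f)) (Rep (e, f))"
      using ext_prod_of_has_subdim(3)[OF ef(1) X] .
    also have "p + 2 - e = p - q + 1" using q np by simp
    \<comment> \<open>The surplus of \<open>q - f\<close> dimensions at \<open>j\<close> is taken
      from the quotient and added to the subrepresentation, whose dimension becomes
      \<open>(q + 1, q)\<close>.\<close>
    also have "p - f = (p - q) + (q - f)" using q np by simp
    also have "ext_prod (Rep (p - q + 1, p - q + (q - f))) (Rep (e, f)) =
        ext_prod (Rep (p - q + 1, p - q)) (ext_prod (Rep (0, q - f)) (Rep (e, f)) :: 'a rep set)"
      unfolding ext_prod_Rep_sink[symmetric] by (rule ext_prod_Rep_assoc)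
    also have "\<dots> \<subseteq> ext_prod (Rep (p - q + 1, p - q)) (Rep (q + 1, q))"
      using ext_prod_Rep_subset[of "(0, q - f)" "(e, f)"] q by (intro ext_prod_mono) auto
    also have "\<dots> \<subseteq> ext_prod (Rep (p - n + 1, p - n)) (Rep (n + 1, n))"
      by (rule ext_prod_preinj_balance[OF q(2) np])
    finally show ?thesis .
  qed
  then have "Rep (p + 2, p) \<subseteq> (ext_prod (Rep (p - n + 1, p - n)) (Rep (n + 1, n)) :: 'a rep set)" by blast
  moreover have "ext_prod (Rep (m + 1, m)) (Rep (n + 1, n)) \<subseteq> (Rep (m + n + 2, m + n) :: 'a rep set)"
    using ext_prod_Rep_subset[of "(m + 1, m)" "(n + 1, n)"] by simp
  ultimately show ?thesis by (intro equalityI) (simp_all add: p_def)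
qed

lemma ext_prod_preproj_preproj:
  assumes "n \<le> m + 1"
  shows "ext_prod (Rep (m, m + 1)) (Rep (n, n + 1)) = (Rep (m + n, m + n + 2) :: 'a::field_char_0 rep set)"
  using ext_prod_Rep_dual[OF ext_prod_preinj_preinj[OF assms]] by (simp add: add.commute)

section \<open>Products with a regular left factor\<close>

lemma ext_prod_regular_regular:
  "ext_prod (Rep (r, r)) (Rep (s, s)) = (Rep (r + s, r + s) :: 'a::{alg_closed_field, field_char_0} rep set)"
proof (induction s)
  case 0
  then show ?case by (simp add: ext_prod_Rep_sink)
next
  case (Suc s)
  have "ext_prod (Rep (r, r)) (Rep (Suc s, Suc s)) =
      ext_prod (Rep (r, r)) (ext_prod (Rep (s, s)) (Rep (1, 1)) :: 'a rep set)"
    by (simp add: ext_prod_regular_one[simplified])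
  also have "\<dots> = Rep (r + Suc s, r + Suc s)"
    unfolding ext_prod_Rep_assoc[symmetric] Suc by (simp add: ext_prod_regular_one[simplified])
  finally show ?case .
qed

lemma ext_prod_regular_preproj_general:
  "ext_prod (Rep (r, r)) (Rep (m, m + 1)) =
    (Rep (r + m, r + m + 1) :: 'a::{alg_closed_field, field_char_0} rep set)"
proof (induction r arbitrary: m)
  case 0
  then show ?case by (simp add: ext_prod_Rep_source)
next
  case (Suc r)
  have "ext_prod (Rep (Suc r, Suc r)) (Rep (m, m + 1)) =
      ext_prod (ext_prod (Rep (r, r)) (Rep (1, 1))) (Rep (m, m + 1) :: 'a rep set)"
    by (simp add: ext_prod_regular_one[simplified])
  also have "\<dots> = ext_prod (Rep (r, r)) (Rep (m + 1, m + 1 + 1))"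
    unfolding ext_prod_Rep_assoc ext_prod_regular_preproj by simp
  also have "\<dots> = Rep (Suc r + m, Suc r + m + 1)" unfolding Suc by simp
  finally show ?case .
qed

section \<open>Standard words\<close>

definition rep_prod :: "dimvec list \<Rightarrow> 'a::field rep set" where
  "rep_prod w = foldr ext_prod (map Rep w) (Rep (0, 0))"

lemma rep_prod_simps [simp]:
  "rep_prod [] = Rep (0, 0)" "rep_prod (\<alpha> # w) = ext_prod (Rep \<alpha>) (rep_prod w)"
  by (simp_all add: rep_prod_def)

lemma rep_prod_Reps: "rep_prod w \<subseteq> (\<Union>\<alpha>. Rep \<alpha>)"
  by (cases w) (auto simp: ext_prod_Reps)

lemma Rep_Reps: "Rep \<alpha> \<subseteq> (\<Union>\<alpha>. Rep \<alpha>)"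
  by auto

lemma rep_prod_subset: "rep_prod w \<subseteq> Rep (sum_list w)"
proof (induction w)
  case (Cons \<alpha> w)
  then show ?case using ext_prod_mono[OF order_refl Cons] ext_prod_Rep_subset by fastforce
qed (simp add: zero_prod_def)

lemma ext_prod_unit_left: "ext_prod (Rep (0, 0)) (rep_prod w) = (rep_prod w :: 'a::field_char_0 rep set)"
proof (cases w)
  case (Cons \<alpha> v)
  have "ext_prod (Rep (0, 0)) (Rep \<alpha>) = (Rep \<alpha> :: 'a rep set)"
    by (cases \<alpha>) (simp add: ext_prod_Rep_source)
  then show ?thesis
    using ext_prod_assoc[OF Rep_Reps Rep_Reps rep_prod_Reps] Cons by (metis rep_prod_simps(2))
qed (simp add: ext_prod_Rep_source)

lemma rep_prod_single: "rep_prod [\<alpha>] = (Rep \<alpha> :: 'a::field_char_0 rep set)"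
  by (cases \<alpha>) (simp add: ext_prod_Rep_sink)

lemma rep_prod_append:
  "rep_prod (u @ v) = ext_prod (rep_prod u) (rep_prod v :: 'a::field_char_0 rep set)"
proof (induction u)
  case (Cons \<alpha> u)
  then show ?case
    using ext_prod_assoc[OF Rep_Reps rep_prod_Reps rep_prod_Reps]
    by (metis append_Cons rep_prod_simps(2))
qed (simp add: ext_prod_unit_left)

lemma rep_prod_subst:
  "rep_prod w = (rep_prod w' :: 'a::field_char_0 rep set) \<Longrightarrow> rep_prod (u @ w @ v) = (rep_prod (u @ w' @ v) :: 'a rep set)"
  by (simp add: rep_prod_append)

lemma transpose_rep_prod:
  "transpose_rep ` rep_prod w = (rep_prod (rev (map prod.swap w)) :: 'a::field_char_0 rep set)"
proof (induction w)
  case Nil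
  then show ?case by (simp add: transpose_rep_image_Rep)
next
  case (Cons \<alpha> w)
  have "transpose_rep ` Rep \<alpha> = (Rep (prod.swap \<alpha>) :: 'a rep set)"
    by (cases \<alpha>) (simp add: transpose_rep_image_Rep)
  moreover have "transpose_rep ` rep_prod (\<alpha> # w) =
      (ext_prod (transpose_rep ` rep_prod w) (transpose_rep ` Rep \<alpha>) :: 'a rep set)"
    by (simp add: transpose_ext_prod[OF Rep_Reps rep_prod_Reps])
  ultimately have "transpose_rep ` rep_prod (\<alpha> # w) =
      (ext_prod (rep_prod (rev (map prod.swap w))) (rep_prod [prod.swap \<alpha>]) :: 'a rep set)"
    unfolding Cons rep_prod_single by metis
  then show ?case by (simp add: rep_prod_append del: rep_prod_simps)
qed

definition dim_P :: "nat \<Rightarrow> dimvec" where "dim_P m = (m, m + 1)"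
definition dim_I :: "nat \<Rightarrow> dimvec" where "dim_I n = (n + 1, n)"

lemma swap_dim: "prod.swap (dim_P m) = dim_I m" "prod.swap (dim_I m) = dim_P m"
  by (simp_all add: dim_P_def dim_I_def)

definition standard_word :: "nat list \<Rightarrow> nat \<Rightarrow> nat list \<Rightarrow> dimvec list" where
  "standard_word ms s ns = map dim_P ms @ [(s, s)] @ map dim_I ns"

lemma rev_swap_standard_word:
  "rev (map prod.swap (standard_word ms s ns)) = standard_word (rev ns) s (rev ms)"
  by (simp add: standard_word_def rev_map swap_dim comp_def)

lemma not_sorted_adjacent:
  assumes "\<not> sorted (xs :: 'a::linorder list)"
  obtains u x y v where "xs = u @ x # y # v" "y < x"
proof -
  have "\<exists>u x y v. xs = u @ x # y # v \<and> y < x"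
    using assms
  proof (induction xs rule: induct_list012)
    case (3 x y zs)
    show ?case
    proof (cases "y < x")
      case True
      then show ?thesis by (metis append_Nil)
    next
      case False
      then have "\<not> sorted (y # zs)" using 3(3) by (simp only: sorted2) simp
      then obtain u a b v where "y # zs = u @ a # b # v" "b < a" using 3(2) by blast
      then show ?thesis by (metis append_Cons)
    qed
  qed auto
  then show thesis using that by blast
qed

text \<open>
  Balancing an adjacent descent \<open>(m, n)\<close> keeps \<open>m + n\<close> and lowers the entry with the larger weight.
\<close>

fun potential :: "nat list \<Rightarrow> nat" where
  "potential [] = 0"
| "potential (x # xs) = Suc (length xs) * x + potential xs"

lemma potential_append_less:
  "length v = length w \<Longrightarrow> potential v < potential w \<Longrightarrow> potential (u @ v) < potential (u @ w)"
  by (induction u) auto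

text \<open>By \<open>ext_prod_preproj_preproj\<close> a product of two factors depends only on the
  sum of the indices, as long as the right index exceeds the left by at most one. A descent
  satisfies this, and so does the balanced pair that replaces it.\<close>

lemma rep_prod_sort_preproj:
  "\<exists>ms'. sorted ms' \<and> rep_prod (map dim_P ms) = (rep_prod (map dim_P ms') :: 'a::field_char_0 rep set)"
proof (induction ms rule: measure_induct_rule[of potential])
  case (less ms)
  show ?case
  proof (cases "sorted ms")
    case False
    then obtain u m n v where ms: "ms = u @ m # n # v" "n < m" using not_sorted_adjacent by blast
    \<comment> \<open>Rounding down on the left leaves \<open>y = x\<close> or
      \<open>y = x + 1\<close>, so the new pair is ascending and still in the range of the
      relation.\<close>
    define x y where "x = (m + n) div 2" and "y = m + n - x"
    have xy: "x + y = m + n" "x < m" "y \<le> x + 1" using ms(2) by (auto simp: x_def y_def)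
    define ms' where "ms' = u @ x # y # v"
    have "Suc (Suc (length v)) * x + Suc (length v) * y = Suc (length v) * (x + y) + x"
      by (simp add: algebra_simps)
    also have "\<dots> < Suc (length v) * (m + n) + m" using xy by simp
    also have "\<dots> = Suc (Suc (length v)) * m + Suc (length v) * n" by (simp add: algebra_simps)
    finally have "potential ms' < potential ms"
      unfolding ms ms'_def by (intro potential_append_less) simp_all
    from less.IH[OF this] obtain ms'' where ms'':
      "sorted ms''" "rep_prod (map dim_P ms') = (rep_prod (map dim_P ms'') :: 'a rep set)" by blast
    have "rep_prod [dim_P m, dim_P n] = (Rep (m + n, m + n + 2) :: 'a rep set)"
      using ext_prod_preproj_preproj[of n m, where ?'a = 'a] ms(2)
        rep_prod_append[of "[dim_P m]" "[dim_P n]", where ?'a = 'a]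
      unfolding rep_prod_single by (simp add: dim_P_def del: rep_prod_simps)
    moreover have "rep_prod [dim_P x, dim_P y] = (Rep (x + y, x + y + 2) :: 'a rep set)"
      using ext_prod_preproj_preproj[of y x, where ?'a = 'a] xy
        rep_prod_append[of "[dim_P x]" "[dim_P y]", where ?'a = 'a]
      unfolding rep_prod_single by (simp add: dim_P_def del: rep_prod_simps)
    ultimately have "rep_prod [dim_P m, dim_P n] = (rep_prod [dim_P x, dim_P y] :: 'a rep set)"
      using xy by metis
    from rep_prod_subst[OF this, of "map dim_P u" "map dim_P v"]
    have "rep_prod (map dim_P ms) = (rep_prod (map dim_P ms') :: 'a rep set)"
      by (simp add: ms ms'_def del: rep_prod_simps)
    then show ?thesis using ms'' by metis
  qed blast
qed

lemma rep_prod_sort_preinj: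
  "\<exists>ns'. sorted (rev ns') \<and> rep_prod (map dim_I ns) = (rep_prod (map dim_I ns') :: 'a::field_char_0 rep set)"
proof -
  have *: "transpose_rep ` rep_prod (map dim_P ms) = (rep_prod (map dim_I (rev ms)) :: 'a rep set)" for ms
    by (simp add: transpose_rep_prod swap_dim comp_def rev_map)
  obtain ms' where "sorted ms'"
    "rep_prod (map dim_P (rev ns)) = (rep_prod (map dim_P ms') :: 'a rep set)"
    using rep_prod_sort_preproj by blast
  then show ?thesis using *[of "rev ns"] *[of ms'] by (intro exI[of _ "rev ms'"]) simp
qed

lemma rep_prod_sort_standard:
  "\<exists>ms' ns'. sorted ms' \<and> sorted (rev ns') \<and>
    rep_prod (standard_word ms s ns) = (rep_prod (standard_word ms' s ns') :: 'a::field_char_0 rep set)"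
proof -
  obtain ms' where 1: "sorted ms'" "rep_prod (map dim_P ms) = (rep_prod (map dim_P ms') :: 'a rep set)"
    using rep_prod_sort_preproj by blast
  obtain ns' where 2: "sorted (rev ns')" "rep_prod (map dim_I ns) = (rep_prod (map dim_I ns') :: 'a rep set)"
    using rep_prod_sort_preinj by blast
  have "rep_prod (standard_word ms s ns) = (rep_prod (standard_word ms' s ns') :: 'a rep set)"
    unfolding standard_word_def rep_prod_append 1 2 ..
  then show ?thesis using 1 2 by blast
qed

lemma rep_prod_merge:
  assumes "ext_prod (Rep \<alpha>) (Rep \<beta>) = (Rep \<gamma> :: 'a::field_char_0 rep set)"
  shows "rep_prod (\<alpha> # \<beta> # w) = (rep_prod (\<gamma> # w) :: 'a rep set)"
  using ext_prod_assoc[OF Rep_Reps Rep_Reps rep_prod_Reps] assms by (metis rep_prod_simps(2))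

text \<open>Multiplication by \<open>i\<close> on the left has three cases. Without a preprojective
  factor, \<open>i * \<delta>_s = I(s)\<close>. Otherwise
  \<open>i * P(m) = \<delta>_(m + 1)\<close>, which merges with \<open>\<delta>_s\<close> if no
  further \<open>P\<close> follows and turns a following \<open>P(m2)\<close> into
  \<open>P(m + 1 + m2)\<close>. The result may be unsorted.\<close>

lemma rep_prod_standard_exists:
  assumes "set w \<subseteq> {(1, 0), (0, 1)}"
  shows "\<exists>ms s ns. rep_prod w =
    (rep_prod (standard_word ms s ns) :: 'a::{alg_closed_field, field_char_0} rep set)"
  using assms
proof (induction w)
  case Nil
  have "rep_prod [] = (rep_prod (standard_word [] 0 []) :: 'a rep set)"
    unfolding standard_word_def by (simp add: ext_prod_Rep_source)
  then show ?case by blast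
next
  case (Cons \<alpha> w)
  then obtain ms s ns where w: "rep_prod w = (rep_prod (standard_word ms s ns) :: 'a rep set)" by auto
  then have aw: "rep_prod (\<alpha> # w) = (rep_prod (\<alpha> # standard_word ms s ns) :: 'a rep set)" by simp
  have i: "rep_prod ((1, 0) # dim_P m # v) = (rep_prod ((m + 1, m + 1) # v) :: 'a rep set)" for m v
    unfolding dim_P_def using ext_prod_Rep_source[of 1 m "m + 1", where ?'a = 'a]
    by (intro rep_prod_merge) simp
  consider "\<alpha> = (0, 1)" | "\<alpha> = (1, 0)" "ms = []" | m where "\<alpha> = (1, 0)" "ms = [m]"
    | m m2 ms2 where "\<alpha> = (1, 0)" "ms = m # m2 # ms2"
    using Cons.prems by (cases ms rule: remdups_adj.cases) auto
  then show ?case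
  proof cases
    case 1
    then have "\<alpha> # standard_word ms s ns = standard_word (0 # ms) s ns"
      by (simp add: standard_word_def dim_P_def)
    then show ?thesis using aw by metis
  next
    case 2
    have "rep_prod ((1, 0) # (s, s) # map dim_I ns) = (rep_prod (dim_I s # map dim_I ns) :: 'a rep set)"
      unfolding dim_I_def using ext_prod_Rep_source[of 1 s s, where ?'a = 'a]
      by (intro rep_prod_merge) simp
    \<comment> \<open>The regular factor has been used up by \<open>I(s)\<close>; the unit
      \<open>\<delta>_0\<close> takes its place.\<close>
    also have "\<dots> = rep_prod (standard_word [] 0 (s # ns))"
      unfolding standard_word_def using ext_prod_unit_left[of "map dim_I (s # ns)", where ?'a = 'a] by simp
    finally have "rep_prod (\<alpha> # standard_word ms s ns) =
        (rep_prod (standard_word [] 0 (s # ns)) :: 'a rep set)"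
      using 2 by (simp add: standard_word_def)
    then show ?thesis using aw by metis
  next
    case 3
    have "rep_prod (\<alpha> # standard_word ms s ns) =
        (rep_prod ((m + 1, m + 1) # (s, s) # map dim_I ns) :: 'a rep set)"
      using 3 i[of m "(s, s) # map dim_I ns"] by (simp add: standard_word_def)
    also have "\<dots> = rep_prod (standard_word [] (m + 1 + s) ns)"
      unfolding standard_word_def using rep_prod_merge[OF ext_prod_regular_regular[of "m + 1" s, where ?'a = 'a], of "map dim_I ns"]
      by simp
    finally show ?thesis using aw by metis
  next
    case 4
    define v where "v = map dim_P ms2 @ [(s, s)] @ map dim_I ns"
    have "rep_prod (\<alpha> # standard_word ms s ns) =
        (rep_prod ((m + 1, m + 1) # dim_P m2 # v) :: 'a rep set)"
      using 4 i[of m "dim_P m2 # v"] by (simp add: standard_word_def v_def)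
    also have "\<dots> = rep_prod (dim_P (m + 1 + m2) # v)"
      unfolding dim_P_def by (rule rep_prod_merge[OF ext_prod_regular_preproj_general])
    also have "\<dots> = rep_prod (standard_word ((m + 1 + m2) # ms2) s ns)"
      by (simp add: standard_word_def v_def)
    finally show ?thesis using aw by metis
  qed
qed

section \<open>Words in the generators of the composition monoid\<close>

lemma composition_monoid_rep_prod:
  assumes "X \<in> composition_monoid"
  shows "\<exists>w. set w \<subseteq> {(1, 0), (0, 1)} \<and> X = (rep_prod w :: 'a::field_char_0 rep set)"
  using assms unfolding composition_monoid_def
proof induction
  case one
  then show ?case by (intro exI[of _ "[]"]) (simp add: ext_monoid_def)
next
  case (incl h)
  then show ?case using rep_prod_single by (metis empty_iff insert_iff list.set(1,2) subsetI)
next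
  case (mult x y)
  then obtain u v where "set u \<subseteq> {(1, 0), (0, 1)}" "x = rep_prod u"
    "set v \<subseteq> {(1, 0), (0, 1)}" "y = rep_prod v" by blast
  then show ?case using rep_prod_append[of u v, where ?'a = 'a]
    by (intro exI[of _ "u @ v"]) (simp add: ext_monoid_def)
qed

lemma delta_eq_Rep: "delta s = (Rep (s, s) :: 'a::field_char_0 rep set)"
proof -
  have 1: "Rep (1, 0) [^]\<^bsub>ext_monoid\<^esub> n = (Rep (n, 0) :: 'a rep set)" for n :: nat
    by (induction n) (simp_all add: nat_pow_def ext_monoid_def ext_prod_Rep_source)
  have 2: "Rep (0, 1) [^]\<^bsub>ext_monoid\<^esub> n = (Rep (0, n) :: 'a rep set)" for n :: nat
    by (induction n) (simp_all add: nat_pow_def ext_monoid_def ext_prod_Rep_sink)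
  show ?thesis
    unfolding delta_def 1 2 by (simp add: ext_monoid_def ext_prod_Rep_source)
qed

lemma foldr_standard_word:
  "foldr (\<lambda>A B. A \<otimes>\<^bsub>ext_monoid\<^esub> B)
     (map (\<lambda>m. Rep (dimv (preproj m :: 'a rep))) ms @ [delta s] @
      map (\<lambda>n. Rep (dimv (preinj n :: 'a rep))) ns) \<one>\<^bsub>ext_monoid\<^esub> =
    (rep_prod (standard_word ms s ns) :: 'a::field_char_0 rep set)"
  by (simp add: rep_prod_def standard_word_def dimv_preproj dimv_preinj delta_eq_Rep ext_monoid_def
      dim_P_def dim_I_def comp_def del: foldr_append)

section \<open>Dimension vectors of subrepresentations of extensions\<close>

text \<open>A subspace \<open>S\<close> of the middle term has an image \<open>P\<close> in the
  quotient and an intersection \<open>Q\<close> with the image of \<open>F\<close>. The kernel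
  \<open>U\<close> of \<open>T\<close> is this intersection in the coordinates of \<open>S\<close>,
  so the dimensions \<open>r\<close> and \<open>t\<close> add up to \<open>p\<close>.\<close>

lemma biprod_split_mono:
  assumes b: "biprod c a F F' G G'"
    and S: "(S :: 'a::field_char_0 mat) \<in> carrier_mat (c + a) p" "S' \<in> carrier_mat p (c + a)" "S' * S = 1\<^sub>m p"
  obtains r t P P' T T' U U' Q Q' where "p = t + r" "biprod t r U U' T T'"
    "P \<in> carrier_mat a r" "P' \<in> carrier_mat r a" "P' * P = 1\<^sub>m r" "G * S = P * T"
    "Q \<in> carrier_mat c t" "Q' \<in> carrier_mat t c" "Q' * Q = 1\<^sub>m t" "F * Q = S * U"
proof -
  have F: "F \<in> carrier_mat (c + a) c" "F' \<in> carrier_mat c (c + a)" "G \<in> carrier_mat a (c + a)"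
    using b by (auto simp: biprod_def)
  have GS: "G * S \<in> carrier_mat a p" using F S by simp
  obtain r P P' T T' where R: "P \<in> carrier_mat a r" "P' \<in> carrier_mat r a" "T \<in> carrier_mat r p"
    "T' \<in> carrier_mat p r" "G * S = P * T" "P' * P = 1\<^sub>m r" "T * T' = 1\<^sub>m r"
    using rank_factorization[OF GS] .
  obtain t U U' where U: "p = t + r" "biprod t r U U' T T'"
    using biprod_complete_epi[OF R(3,4,7)] .
  have cU: "U \<in> carrier_mat p t" "U' \<in> carrier_mat t p" "U' * U = 1\<^sub>m t" "T * U = 0\<^sub>m r t"
    using U by (auto simp: biprod_def)
  have "G * (S * U) = P * (T * U)" using mat_assoc[of G S U] R F S cU by (simp add: mat_assoc)
  also have "\<dots> = 0\<^sub>m a t" using cU R by simp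
  finally have SU: "F * (F' * (S * U)) = S * U"
    using biprod_absorb[OF b, of "S * U" t] S cU by simp
  have "(U' * S' * F) * (F' * S * U) = U' * (S' * (F * (F' * (S * U))))"
    using F S cU by (simp add: mat_assoc)
  also have "\<dots> = 1\<^sub>m t" unfolding SU using mat_cancel[OF S(3), of U] S cU by simp
  finally have "(U' * S' * F) * (F' * S * U) = 1\<^sub>m t" .
  moreover have "F * (F' * S * U) = S * U" using SU F S cU by (simp add: mat_assoc)
  ultimately show thesis
    using that[OF U R(1,2,6,5), of "F' * S * U" "U' * S' * F"] F S cU by simp
qed

text \<open>The two pieces are the image in \<open>A\<close> and the intersection with
  \<open>B\<close>, found at each vertex separately; what remains is that the arrows respect
  them.\<close>

lemma has_subdim_extension:
  assumes X: "(X :: 'a::field_char_0 rep) \<in> Rep (c + a, d + b)" and A: "A \<in> Rep (a, b)" and B: "B \<in> Rep (c, d)"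
    and bi: "biprod c a Fi Fi' Gi Gi'" and bj: "biprod d b Fj Fj' Gj Gj'"
    and I: "intertwines B Fi Fj X" "intertwines X Gi Gj A"
    and sub: "has_subdim p q X"
  obtains p1 q1 p2 q2 where "has_subdim p1 q1 A" "has_subdim p2 q2 B" "p = p1 + p2" "q = q1 + q2"
proof -
  obtain Si Si' Sj Sj' Z where S: "Si \<in> carrier_mat (c + a) p" "Si' \<in> carrier_mat p (c + a)" "Si' * Si = 1\<^sub>m p"
    "Sj \<in> carrier_mat (d + b) q" "Sj' \<in> carrier_mat q (d + b)" "Sj' * Sj = 1\<^sub>m q"
    and Z: "\<forall>K\<in>arrows. Z K \<in> carrier_mat q p \<and> K X * Si = Sj * Z K"
    using has_subdimE[OF sub X] .
  obtain ri ti Pi Pi' Ti Ti' Ui Ui' Qi Qi' where i: "p = ti + ri" "biprod ti ri Ui Ui' Ti Ti'"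
    "Pi \<in> carrier_mat a ri" "Pi' \<in> carrier_mat ri a" "Pi' * Pi = 1\<^sub>m ri" "Gi * Si = Pi * Ti"
    "Qi \<in> carrier_mat c ti" "Qi' \<in> carrier_mat ti c" "Qi' * Qi = 1\<^sub>m ti" "Fi * Qi = Si * Ui"
    using biprod_split_mono[OF bi S(1-3)] .
  obtain rj tj Pj Pj' Tj Tj' Uj Uj' Qj Qj' where j: "q = tj + rj" "biprod tj rj Uj Uj' Tj Tj'"
    "Pj \<in> carrier_mat b rj" "Pj' \<in> carrier_mat rj b" "Pj' * Pj = 1\<^sub>m rj" "Gj * Sj = Pj * Tj"
    "Qj \<in> carrier_mat d tj" "Qj' \<in> carrier_mat tj d" "Qj' * Qj = 1\<^sub>m tj" "Fj * Qj = Sj * Uj"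
    using biprod_split_mono[OF bj S(4-6)] .
  have ci: "Ti \<in> carrier_mat ri p" "Ti' \<in> carrier_mat p ri" "Ti * Ti' = 1\<^sub>m ri" "Ui \<in> carrier_mat p ti"
    using i(1,2) by (auto simp: biprod_def)
  have cj: "Tj \<in> carrier_mat rj q" "Uj \<in> carrier_mat q tj" "Uj' \<in> carrier_mat tj q"
    using j(1,2) by (auto simp: biprod_def)
  have cF: "Fi \<in> carrier_mat (c + a) c" "Gi \<in> carrier_mat a (c + a)" "Fj \<in> carrier_mat (d + b) d"
    "Gj \<in> carrier_mat b (d + b)" "Fj' \<in> carrier_mat d (d + b)" "Fj' * Fj = 1\<^sub>m d" "Gj * Fj = 0\<^sub>m b d"
    using bi bj by (auto simp: biprod_def)
  have ar: "K X \<in> carrier_mat (d + b) (c + a)" "K A \<in> carrier_mat b a" "K B \<in> carrier_mat d c"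
    "Z K \<in> carrier_mat q p" "K X * Si = Sj * Z K" "Fj * K B = K X * Fi" "Gj * K X = K A * Gi"
    if "K \<in> arrows" for K
    using arrow_Rep[OF X that] arrow_Rep[OF A that] arrow_Rep[OF B that] Z I that
    unfolding intertwines_def by blast+
  have "has_subdim ri rj A"
  proof (rule has_subdimI[OF A i(3-5) j(3-5)])
    fix K :: "'a rep \<Rightarrow> 'a mat" assume K: "K \<in> arrows"
    note c = ar[OF K]
    have "K A * Pi = K A * (Pi * (Ti * Ti'))" using i(3) ci by simp
    also have "\<dots> = K A * ((Gi * Si) * Ti')" unfolding i(6) using i(3) ci by (simp add: mat_assoc)
    also have "\<dots> = (K A * Gi) * (Si * Ti')" using c(2) S(1) cF(2) ci by (simp add: mat_assoc)
    also have "\<dots> = Gj * ((K X * Si) * Ti')"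
      unfolding c(7)[symmetric] using c(1) S(1) cF(4) ci by (simp add: mat_assoc)
    also have "\<dots> = (Gj * Sj) * (Z K * Ti')"
      unfolding c(5) using c(4) S(4) cF(4) ci by (simp add: mat_assoc)
    also have "\<dots> = Pj * (Tj * (Z K * Ti'))"
      unfolding j(6) using c(4) j(3) cj ci by (simp add: mat_assoc)
    finally show "\<exists>Y\<in>carrier_mat rj ri. K A * Pi = Pj * Y"
      using c(4) cj ci by (intro bexI[of _ "Tj * (Z K * Ti')"]) auto
  qed
  moreover have "has_subdim ti tj B"
  proof (rule has_subdimI[OF B i(7-9) j(7-9)])
    fix K :: "'a rep \<Rightarrow> 'a mat" assume K: "K \<in> arrows"
    note c = ar[OF K]
    have "Fj * (K B * Qi) = (K X * Fi) * Qi"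
      unfolding c(6)[symmetric] using c(3) cF(3) i(7) by (simp add: mat_assoc)
    also have "\<dots> = K X * (Si * Ui)" using c(1) cF(1) i(7,10) by (simp add: mat_assoc)
    also have "\<dots> = (K X * Si) * Ui" using c(1) S(1) ci by (simp add: mat_assoc)
    also have "\<dots> = Sj * (Z K * Ui)" unfolding c(5) using c(4) S(4) ci by (simp add: mat_assoc)
    finally have 1: "Fj * (K B * Qi) = Sj * (Z K * Ui)" .
    have "Pj * (Tj * (Z K * Ui)) = (Gj * Sj) * (Z K * Ui)"
      unfolding j(6) using c(4) j(3) cj ci by (simp add: mat_assoc)
    also have "\<dots> = Gj * (Fj * (K B * Qi))" unfolding 1 using c(4) S(4) cF(4) ci by (simp add: mat_assoc)
    also have "\<dots> = 0\<^sub>m b ti"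
      using mat_cancel_zero[OF cF(7), of "K B * Qi"] c(3) cF i(7) by simp
    finally have "Pj' * (Pj * (Tj * (Z K * Ui))) = 0\<^sub>m rj ti" using j(4) by simp
    then have "Tj * (Z K * Ui) = 0\<^sub>m rj ti"
      using mat_cancel[OF j(5), of "Tj * (Z K * Ui)"] j(3,4) cj by simp
    \<comment> \<open>The induced arrow maps the intersection with \<open>B\<close> at
      \<open>i\<close> into the one at \<open>j\<close>, both in the coordinates of the
      subrepresentation.\<close>
    then have 2: "Uj * (Uj' * (Z K * Ui)) = Z K * Ui"
      using biprod_absorb[OF j(2), of "Z K * Ui" ti] c(4) ci j(1) by simp
    have "Fj * (K B * Qi) = (Sj * Uj) * (Uj' * (Z K * Ui))"
      using 1 2 S(4) cj c(4) ci by (simp add: mat_assoc)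
    also have "\<dots> = Fj * (Qj * (Uj' * (Z K * Ui)))"
      unfolding j(10)[symmetric] using cF(3) j(7) cj c(4) ci by (simp add: mat_assoc)
    finally have "Fj' * (Fj * (K B * Qi)) = Fj' * (Fj * (Qj * (Uj' * (Z K * Ui))))" by simp
    then have "K B * Qi = Qj * (Uj' * (Z K * Ui))"
      using mat_cancel[OF cF(6), of "K B * Qi"] mat_cancel[OF cF(6), of "Qj * (Uj' * (Z K * Ui))"]
        cF c(3) j(7) by simp
    then show "\<exists>Y\<in>carrier_mat tj ti. K B * Qi = Qj * Y"
      using c(4) cj ci by (intro bexI[of _ "Uj' * (Z K * Ui)"]) auto
  qed
  ultimately show thesis using that i(1) j(1) by (metis add.commute)
qed

text \<open>The witness is the direct sum, with its arrows written through inclusions and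
  projections.\<close>

lemma exists_extension:
  assumes A: "(A :: 'a::field_char_0 rep) \<in> Rep (a, b)" and B: "B \<in> Rep (c, d)"
  obtains X Fi Fi' Gi Gi' Fj Fj' Gj Gj' where "X \<in> Rep (c + a, d + b)"
    "biprod c a Fi Fi' Gi Gi'" "biprod d b Fj Fj' Gj Gj'"
    "intertwines B Fi Fj X" "intertwines X Gi Gj A"
proof -
  have ex: "\<exists>F F' G G'. biprod n k F F' G (G' :: 'a mat)" for n k
    using biprod_complete_mono[OF delta_mat_carrier delta_mat_carrier delta_mat_mult[of n "n + k"]]
    by (metis add_left_cancel le_add1)
  obtain Fi Fi' Gi Gi' where bi: "biprod c a Fi Fi' Gi (Gi' :: 'a mat)" using ex by blast
  obtain Fj Fj' Gj Gj' where bj: "biprod d b Fj Fj' Gj (Gj' :: 'a mat)" using ex by blast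
  have c: "Fi \<in> carrier_mat (c + a) c" "Fi' \<in> carrier_mat c (c + a)" "Gi \<in> carrier_mat a (c + a)"
    "Fj \<in> carrier_mat (d + b) d" "Gj \<in> carrier_mat b (d + b)" "Gj' \<in> carrier_mat (d + b) b"
    and e: "Fi' * Fi = 1\<^sub>m c" "Gi * Fi = 0\<^sub>m a c" "Gj * Gj' = 1\<^sub>m b" "Gj * Fj = 0\<^sub>m b d"
    using bi bj by (auto simp: biprod_def)
  define X where "X = (Fj * fst B * Fi' + Gj' * fst A * Gi, Fj * snd B * Fi' + Gj' * snd A * Gi)"
  have KX: "K X = Fj * K B * Fi' + Gj' * K A * Gi" if "K \<in> arrows" for K
    using that by (auto simp: X_def)
  have car: "K A \<in> carrier_mat b a" "K B \<in> carrier_mat d c"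
    "Fj * K B * Fi' \<in> carrier_mat (d + b) (c + a)" "Gj' * K A * Gi \<in> carrier_mat (d + b) (c + a)"
    if "K \<in> arrows" for K
    using arrow_Rep[OF A that] arrow_Rep[OF B that] c by auto
  have "X \<in> Rep (c + a, d + b)"
    by (rule RepI) (simp add: KX car)
  moreover have "intertwines B Fi Fj X"
    unfolding intertwines_def
  proof
    fix K :: "'a rep \<Rightarrow> 'a mat" assume K: "K \<in> arrows"
    note k = car[OF K]
    have "K X * Fi = Fj * K B * Fi' * Fi + Gj' * K A * Gi * Fi"
      unfolding KX[OF K] by (rule add_mult_distrib_mat[OF k(3,4) c(1)])
    also have "\<dots> = Fj * K B" using c k(1,2) e by (simp add: mat_assoc)
    finally show "Fj * K B = K X * Fi" ..
  qed
  moreover have "intertwines X Gi Gj A"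
    unfolding intertwines_def
  proof
    fix K :: "'a rep \<Rightarrow> 'a mat" assume K: "K \<in> arrows"
    note k = car[OF K]
    have "Gj * K X = Gj * (Fj * K B * Fi') + Gj * (Gj' * K A * Gi)"
      unfolding KX[OF K] by (rule mult_add_distrib_mat[OF c(5) k(3,4)])
    also have "Gj * (Fj * K B * Fi') = 0\<^sub>m b (c + a)"
      using mat_cancel_zero[OF e(4), of "K B * Fi'"] c k(1,2) by (simp add: mat_assoc)
    also have "Gj * (Gj' * K A * Gi) = K A * Gi"
      using mat_cancel[OF e(3), of "K A * Gi"] c k(1,2) by (simp add: mat_assoc)
    finally show "Gj * K X = K A * Gi" using c k(1) by simp
  qed
  ultimately show thesis using that bi bj by blast
qed

text \<open>
  The functional \<open>(c, d) \<mapsto> (k + 1) c - (k + 2) d\<close> is the Euler form against the dimension vector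
  of the preinjective indecomposable of index \<open>k\<close>; its maximum on subrepresentations is bounded by \<open>t\<close>.
\<close>

definition euler_bounded :: "nat \<Rightarrow> nat \<Rightarrow> 'a::field rep \<Rightarrow> bool" where
  "euler_bounded k t X \<longleftrightarrow> (\<forall>c d. has_subdim c d X \<longrightarrow> (k + 1) * c \<le> (k + 2) * d + t)"

text \<open>The functional is linear and dimension vectors of subrepresentations split along an
  extension, so the bounds of the chosen representatives add up.\<close>

lemma euler_bounded_rep_prod:
  assumes "\<forall>\<alpha>\<in>set w. \<exists>A\<in>Rep \<alpha>. euler_bounded k (\<tau> \<alpha>) (A :: 'a::field_char_0 rep)"
    and "\<exists>A\<in>Rep (0, 0). euler_bounded k 0 (A :: 'a rep)"
  shows "\<exists>X\<in>rep_prod w. euler_bounded k (sum_list (map \<tau> w)) (X :: 'a rep)"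
  using assms(1)
proof (induction w)
  case Nil
  then show ?case using assms(2) by simp
next
  case (Cons \<alpha> w)
  obtain A where A: "A \<in> Rep \<alpha>" "euler_bounded k (\<tau> \<alpha>) (A :: 'a rep)" using Cons.prems by auto
  obtain B where B: "B \<in> rep_prod w" "euler_bounded k (sum_list (map \<tau> w)) (B :: 'a rep)"
    using Cons by auto
  obtain a b where ab: "\<alpha> = (a, b)" by (cases \<alpha>)
  obtain c d where cd: "B \<in> Rep (c, d)" using B(1) rep_prod_Reps by fast
  have A': "A \<in> Rep (a, b)" using A ab by simp
  obtain X Fi Fi' Gi Gi' Fj Fj' Gj Gj' where X: "X \<in> Rep (c + a, d + b)"
    "biprod c a Fi Fi' Gi Gi'" "biprod d b Fj Fj' Gj Gj'"
    "intertwines B Fi Fj X" "intertwines X Gi Gj A"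
    using exists_extension[OF A' cd] .
  have "euler_bounded k (\<tau> \<alpha> + sum_list (map \<tau> w)) X"
    unfolding euler_bounded_def
  proof (intro allI impI)
    fix p q assume "has_subdim p q X"
    then obtain p1 q1 p2 q2 where "has_subdim p1 q1 A" "has_subdim p2 q2 B" "p = p1 + p2" "q = q1 + q2"
      using has_subdim_extension[OF X(1) A' cd X(2-5)] by metis
    moreover from this have "(k + 1) * p1 \<le> (k + 2) * q1 + \<tau> \<alpha>"
      "(k + 1) * p2 \<le> (k + 2) * q2 + sum_list (map \<tau> w)"
      using A(2) B(2) unfolding euler_bounded_def by blast+
    ultimately show "(k + 1) * p \<le> (k + 2) * q + (\<tau> \<alpha> + sum_list (map \<tau> w))"
      by (simp add: algebra_simps)
  qed
  moreover have "X \<in> ext_prod (Rep \<alpha>) (rep_prod w)"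
    by (rule ext_prodI[OF A(1) B(1) A' cd X])
  ultimately show ?case by auto
qed

text \<open>An injective arrow forces \<open>c \<le> d\<close> on every subrepresentation, and the
  rectangular identity is injective.\<close>

lemma euler_bounded_wide:
  assumes "a \<le> b"
  shows "\<exists>A\<in>Rep (a, b). euler_bounded k 0 (A :: 'a::field_char_0 rep)"
proof
  let ?A = "(delta_mat b a, delta_mat b a) :: 'a rep"
  show R: "?A \<in> Rep (a, b)" by (simp add: Rep_def)
  show "euler_bounded k 0 ?A"
    unfolding euler_bounded_def
  proof (intro allI impI)
    fix c d assume "has_subdim c d ?A"
    then obtain Si Si' Sj Sj' Z where S: "Si \<in> carrier_mat a c" "Si' \<in> carrier_mat c a" "Si' * Si = 1\<^sub>m c"
      "Sj \<in> carrier_mat b d" and Z': "\<forall>K\<in>arrows. Z K \<in> carrier_mat d c \<and> K ?A * Si = Sj * Z K"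
      using has_subdimE[OF _ R] by metis
    define Y where "Y = Z fst"
    have Z: "Y \<in> carrier_mat d c" "delta_mat b a * Si = Sj * Y" using Z' by (auto simp: Y_def)
    have "(Si' * delta_mat a b * Sj) * Y = Si' * (delta_mat a b * (delta_mat b a * Si))"
      unfolding Z(2) using S Z(1) by (simp add: mat_assoc)
    also have "\<dots> = 1\<^sub>m c" using mat_cancel[OF delta_mat_mult[OF assms], of Si] S by simp
    finally have "c \<le> d" using S Z(1) by (intro left_inv_dim_le[of Y d c "Si' * delta_mat a b * Sj"]) auto
    then have "(k + 1) * c \<le> (k + 1) * d" by (rule mult_le_mono2)
    then show "(k + 1) * c \<le> (k + 2) * d + 0" by simp
  qed
qed

text \<open>
  If \<open>d < c\<close>, the first arrow maps the \<open>c\<close>-dimensional source part onto the \<open>d\<close>-dimensional sink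
  part, and \<open>c = d + 1\<close>. Starting from the kernel of the first arrow, all standard basis vectors
  are then seen to lie in the source part, one after the other.
\<close>

lemma has_subdim_preinj:
  assumes "has_subdim c d (preinj n :: 'a::field_char_0 rep)"
  shows "c \<le> d \<or> c = n + 1 \<and> n \<le> d"
proof (rule disjCI)
  assume "\<not> (c = n + 1 \<and> n \<le> d)"
  show "c \<le> d"
  proof (rule ccontr)
    assume "\<not> c \<le> d"
    then have dc: "d < c" by simp
    obtain S S' Q Q' Z where S: "S \<in> carrier_mat (n + 1) c" "S' \<in> carrier_mat c (n + 1)" "S' * S = 1\<^sub>m c"
      and Q: "Q \<in> carrier_mat n d" "Q' \<in> carrier_mat d n" "Q' * Q = 1\<^sub>m d"
      and Z': "\<forall>K\<in>arrows. Z K \<in> carrier_mat d c \<and> K (preinj n :: 'a rep) * S = Q * Z K"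
      using has_subdimE[OF assms preinj_Rep] .
    define A where "A = (fst (preinj n) :: 'a mat)"
    define B where "B = (snd (preinj n) :: 'a mat)"
    have A: "A \<in> carrier_mat n (n + 1)" and B: "B \<in> carrier_mat n (n + 1)"
      using arrow_Rep[OF preinj_Rep, of fst] arrow_Rep[OF preinj_Rep, of snd] by (simp_all add: A_def B_def)
    define Z1 where "Z1 = Z fst"
    define Z2 where "Z2 = Z snd"
    have Z: "Z1 \<in> carrier_mat d c" "Z2 \<in> carrier_mat d c" "A * S = Q * Z1" "B * S = Q * Z2"
      using Z' by (auto simp: A_def B_def Z1_def Z2_def)
    have Av: "(A *\<^sub>v v) $ i = v $ i" "(B *\<^sub>v v) $ i = v $ Suc i" if "v \<in> carrier_vec (n + 1)" "i < n" for v i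
      using that by (simp_all add: A_def B_def preinj_def scalar_prod_def if_distrib[of "\<lambda>x. x * _"] cong: if_cong)
    obtain r P P' T T' where R: "P \<in> carrier_mat d r" "P' \<in> carrier_mat r d" "T \<in> carrier_mat r c"
      "T' \<in> carrier_mat c r" "Z1 = P * T" "P' * P = 1\<^sub>m r" "T * T' = 1\<^sub>m r"
      using rank_factorization[OF Z(1)] .
    obtain t U U' where U: "c = t + r" "biprod t r U U' T T'"
      using biprod_complete_epi[OF R(3,4,7)] .
    have cU: "U \<in> carrier_mat c t" "U' \<in> carrier_mat t c" "U' * U = 1\<^sub>m t" "T * U = 0\<^sub>m r t"
      using U by (auto simp: biprod_def)
    have ASU: "A * (S * U) = 0\<^sub>m n t"
    proof -
      have "A * (S * U) = (A * S) * U" using A S cU by (simp add: mat_assoc)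
      also have "\<dots> = Q * (P * (T * U))" unfolding Z(3) R(5) using Q R cU by (simp add: mat_assoc)
      also have "\<dots> = 0\<^sub>m n t" unfolding cU(4) using Q(1) R(1) by simp
      finally show ?thesis .
    qed
    \<comment> \<open>\<open>E\<close> is the last basis vector, which spans the kernel of
      \<open>A\<close>. The columns of \<open>S * U\<close> lie in this kernel and are independent,
      hence \<open>t \<le> 1\<close>.\<close>
    define E where "E = mat (n + 1) 1 (\<lambda>(i, j). if i = n then 1 else 0 :: 'a)"
    define L where "L = mat 1 t (\<lambda>(i, j). (S * U) $$ (n, j))"
    have SUE: "S * U = E * L"
    proof (rule eq_matI)
      fix i j assume "i < dim_row (E * L)" "j < dim_col (E * L)"
      then have ij: "i < n + 1" "j < t" by (auto simp: E_def L_def)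
      show "(S * U) $$ (i, j) = (E * L) $$ (i, j)"
      proof (cases "i = n")
        case True
        then show ?thesis using ij S cU by (simp add: E_def L_def scalar_prod_def)
      next
        case False
        have "(S * U) $$ (i, j) = (A *\<^sub>v col (S * U) j) $ i"
          using Av(1)[of "col (S * U) j" i] ij False S cU by simp
        also have "\<dots> = (A * (S * U)) $$ (i, j)" using ij False A S cU by simp
        also have "\<dots> = 0" using ij False by (simp add: ASU)
        finally show ?thesis using ij False by (simp add: E_def L_def scalar_prod_def)
      qed
    qed (use S cU in \<open>auto simp: E_def L_def\<close>)
    have EL: "E \<in> carrier_mat (n + 1) 1" "L \<in> carrier_mat 1 t" by (simp_all add: E_def L_def)
    have "(U' * S' * E) * L = U' * (S' * (S * U))"
      unfolding SUE using S cU EL by (simp add: mat_assoc)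
    also have "\<dots> = 1\<^sub>m t" using mat_cancel[OF S(3), of U] S cU by simp
    finally have "t \<le> 1" using S cU EL by (intro left_inv_dim_le[of L 1 t "U' * S' * E"]) auto
    moreover have "r \<le> d" by (rule left_inv_dim_le[OF R(1,2,6)])
    ultimately have rd: "r = d" "t = 1" "c = d + 1" using U(1) dc by auto
    have PP: "P * P' = 1\<^sub>m d" using mat_mult_left_right_inverse[of P' d P] R rd by simp
    \<comment> \<open>A right inverse of the first arrow of the subrepresentation, which is
      surjective since \<open>r = d\<close>.\<close>
    define W where "W = T' * P'"
    have W: "W \<in> carrier_mat c d" using R by (simp add: W_def)
    have "Z1 * W = P * (T * (T' * P'))" unfolding R(5) W_def using R(1-4) by (simp add: mat_assoc)
    also have "\<dots> = 1\<^sub>m d" using mat_cancel[OF R(7), of P'] R PP by simp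
    finally have ZW: "Z1 * W = 1\<^sub>m d" .
    have base: "\<exists>x\<in>carrier_vec c. S *\<^sub>v x = unit_vec (n + 1) n"
    proof -
      define x where "x = col U 0"
      have x: "x \<in> carrier_vec c" using cU by (auto simp: x_def intro: carrier_vecI)
      have "S *\<^sub>v x = col (S * U) 0"
        unfolding x_def by (rule col_mult2[OF S(1) cU(1), symmetric]) (simp add: rd)
      also have "\<dots> = L $$ (0, 0) \<cdot>\<^sub>v unit_vec (n + 1) n"
        unfolding SUE using rd by (intro eq_vecI) (auto simp: E_def L_def scalar_prod_def)
      finally have Sx: "S *\<^sub>v x = L $$ (0, 0) \<cdot>\<^sub>v unit_vec (n + 1) n" .
      have "L $$ (0, 0) \<noteq> 0"
      proof
        assume "L $$ (0, 0) = 0"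
        then have "S *\<^sub>v x = 0\<^sub>v (n + 1)" unfolding Sx by (intro eq_vecI) auto
        then have "S' *\<^sub>v (S *\<^sub>v x) = 0\<^sub>v c" using S(2) by (simp add: mult_mat_zero_vec)
        then have "x = 0\<^sub>v c" using S x assoc_mult_mat_vec[OF S(2,1) x] by simp
        then have "U' *\<^sub>v x = 0\<^sub>v t" using cU(2) by (simp add: mult_mat_zero_vec)
        moreover have "U' *\<^sub>v x = col (1\<^sub>m t) 0"
          unfolding cU(3)[symmetric] x_def using col_mult2[OF cU(2,1), of 0] rd by simp
        ultimately show False using rd(2) by (simp add: unit_vec_nonzero)
      qed
      then have "S *\<^sub>v (1 / L $$ (0, 0) \<cdot>\<^sub>v x) = unit_vec (n + 1) n"
        using mult_mat_vec[OF S(1) x, of "1 / L $$ (0, 0)"] unfolding Sx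
        by (simp add: smult_smult_assoc)
      then show ?thesis using x by (intro bexI[of _ "1 / L $$ (0, 0) \<cdot>\<^sub>v x"]) auto
    qed
    then obtain x0 where x0: "x0 \<in> carrier_vec c" "S *\<^sub>v x0 = unit_vec (n + 1) n" by blast
    have all: "\<exists>x\<in>carrier_vec c. S *\<^sub>v x = unit_vec (n + 1) l" if "l \<le> n" for l
      using that
    proof (induction l rule: inc_induct)
      case base
      then show ?case using x0 by blast
    next
      case (step l)
      then obtain x where x: "x \<in> carrier_vec c" "S *\<^sub>v x = unit_vec (n + 1) (Suc l)" by blast
      \<comment> \<open>\<open>S y\<close> is a preimage of \<open>B e_(l + 1) = e_l\<close> under
        \<open>A\<close>. As \<open>A\<close> forgets the last coordinate, \<open>S y\<close> is
        \<open>e_l\<close> up to a multiple of \<open>e_n\<close>, which \<open>x0\<close>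
        corrects.\<close>
      define y where "y = W *\<^sub>v (Z2 *\<^sub>v x)"
      have y: "y \<in> carrier_vec c" using W by (auto simp: y_def intro: carrier_vecI)
      have Z2x: "Z2 *\<^sub>v x \<in> carrier_vec d" using Z(2) by (auto intro: carrier_vecI)
      have "A *\<^sub>v (S *\<^sub>v y) = (Q * Z1) *\<^sub>v y"
        using assoc_mult_mat_vec[OF A S(1) y] Z(3) by simp
      also have "\<dots> = Q *\<^sub>v (Z1 *\<^sub>v y)" by (rule assoc_mult_mat_vec[OF Q(1) Z(1) y])
      also have "Z1 *\<^sub>v y = Z2 *\<^sub>v x"
        unfolding y_def using assoc_mult_mat_vec[OF Z(1) W Z2x] ZW Z2x by simp
      also have "Q *\<^sub>v (Z2 *\<^sub>v x) = B *\<^sub>v (S *\<^sub>v x)"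
        using assoc_mult_mat_vec[OF Q(1) Z(2) x(1)] assoc_mult_mat_vec[OF B S(1) x(1)] Z(4) by simp
      finally have AB: "A *\<^sub>v (S *\<^sub>v y) = B *\<^sub>v unit_vec (n + 1) (Suc l)" unfolding x(2) .
      have Sy: "S *\<^sub>v y \<in> carrier_vec (n + 1)" using S by (auto intro: carrier_vecI)
      have Syi: "(S *\<^sub>v y) $ i = (if i = l then 1 else 0)" if "i < n" for i
      proof -
        have "(S *\<^sub>v y) $ i = (B *\<^sub>v unit_vec (n + 1) (Suc l)) $ i"
          using Av(1)[OF Sy that] unfolding AB by simp
        also have "\<dots> = unit_vec (n + 1) (Suc l) $ Suc i" by (rule Av(2)) (use that in auto)
        finally show ?thesis using that step by simp
      qed
      define z where "z = y - (S *\<^sub>v y) $ n \<cdot>\<^sub>v x0"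
      have "S *\<^sub>v z = S *\<^sub>v y - (S *\<^sub>v y) $ n \<cdot>\<^sub>v unit_vec (n + 1) n"
        unfolding z_def using y x0 S(1) mult_mat_vec[OF S(1) x0(1)]
        by (subst mult_minus_distrib_mat_vec[of _ "n + 1" c]) auto
      also have "\<dots> = unit_vec (n + 1) l"
      proof (rule eq_vecI)
        fix i assume "i < dim_vec (unit_vec (n + 1) l :: 'a vec)"
        then have i: "i < n + 1" by simp
        then show "(S *\<^sub>v y - (S *\<^sub>v y) $ n \<cdot>\<^sub>v unit_vec (n + 1) n) $ i = unit_vec (n + 1) l $ i"
          using Syi[of i] step Sy by (cases "i = n") (auto simp del: index_mult_mat_vec)
      qed (use Sy in auto)
      finally show ?case using y x0 by (intro bexI[of _ z]) (auto simp: z_def)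
    qed
    then have "\<forall>l<n + 1. \<exists>x. x \<in> carrier_vec c \<and> S *\<^sub>v x = unit_vec (n + 1) l"
      by (metis Suc_eq_plus1 less_Suc_eq_le)
    then obtain x where x: "\<And>l. l < n + 1 \<Longrightarrow> x l \<in> carrier_vec c \<and> S *\<^sub>v x l = unit_vec (n + 1) l"
      by metis
    define M where "M = mat_of_cols c (map x [0..<n + 1])"
    have M: "M \<in> carrier_mat c (n + 1)"
      unfolding M_def using mat_of_cols_carrier(1)[of c "map x [0..<n + 1]"] by simp
    have colM: "col M l = x l" if "l < n + 1" for l
      using x[OF that] that unfolding M_def by (simp del: upt_Suc)
    have "S * M = 1\<^sub>m (n + 1)"
    proof (rule mat_col_eqI)
      fix l assume "l < dim_col (1\<^sub>m (n + 1) :: 'a mat)"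
      then have l: "l < n + 1" by simp
      show "col (S * M) l = col (1\<^sub>m (n + 1)) l"
        unfolding col_mult2[OF S(1) M l] colM[OF l] using x[OF l] l by simp
    qed (use S M in auto)
    then have "n + 1 \<le> c" using left_inv_dim_le[OF M S(1)] by simp
    moreover have "c \<le> n + 1" by (rule left_inv_dim_le[OF S(1-3)])
    ultimately show False using rd \<open>\<not> (c = n + 1 \<and> n \<le> d)\<close> by simp
  qed
qed

text \<open>The whole representation has the value
  \<open>(k + 1) (n + 1) - (k + 2) n = k + 1 - n\<close>, while \<open>c \<le> d\<close> gives at
  most 0. Truncated subtraction is the maximum of the two.\<close>

lemma euler_bounded_preinj: "euler_bounded k (Suc k - n) (preinj n :: 'a::field_char_0 rep)"
  unfolding euler_bounded_def
proof (intro allI impI)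
  fix c d assume "has_subdim c d (preinj n :: 'a rep)"
  from has_subdim_preinj[OF this] show "(k + 1) * c \<le> (k + 2) * d + (Suc k - n)"
  proof
    assume "c \<le> d"
    then have "(k + 1) * c \<le> (k + 1) * d" by (rule mult_le_mono2)
    then show ?thesis by simp
  next
    assume cd: "c = n + 1 \<and> n \<le> d"
    have "(k + 1) * (n + 1) \<le> (k + 2) * n + (Suc k - n)" by (simp add: algebra_simps)
    also have "\<dots> \<le> (k + 2) * d + (Suc k - n)" using cd by (intro add_mono mult_le_mono2) auto
    finally show ?thesis using cd by simp
  qed
qed

section \<open>Uniqueness\<close>

text \<open>Entries above \<open>k\<close> contribute 0 by truncation. As a function of
  \<open>k\<close> this is the second discrete sum of the multiplicities.\<close>

definition excess :: "nat \<Rightarrow> nat list \<Rightarrow> nat" where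
  "excess k ns = (\<Sum>n\<leftarrow>ns. Suc k - n)"

lemma excess_simps [simp]: "excess k [] = 0" "excess k (n # ns) = Suc k - n + excess k ns"
  by (simp_all add: excess_def)

lemma descending_split:
  assumes "sorted_wrt (\<ge>) (ns :: nat list)"
  obtains u v where "ns = u @ v" "\<forall>n\<in>set u. k < n" "\<forall>n\<in>set v. n \<le> k"
proof -
  have "\<exists>u v. ns = u @ v \<and> (\<forall>n\<in>set u. k < n) \<and> (\<forall>n\<in>set v. n \<le> k)"
    using assms
  proof (induction ns)
    case (Cons a ns)
    show ?case
    proof (cases "a \<le> k")
      case True
      then show ?thesis using Cons.prems by (intro exI[of _ "[]"] exI[of _ "a # ns"]) auto
    next
      case False
      obtain u v where "ns = u @ v" "\<forall>n\<in>set u. k < n" "\<forall>n\<in>set v. n \<le> k" using Cons by auto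
      then show ?thesis using False by (intro exI[of _ "a # u"] exI[of _ v]) auto
    qed
  qed simp
  then show thesis using that by blast
qed

text \<open>Because the indices descend, the factors \<open>I(n)\<close> with
  \<open>n \<le> k\<close> form the tail of the product, and the tail is realized by a
  subrepresentation of every member.\<close>

lemma has_subdim_standard:
  assumes X: "(X :: 'a::field_char_0 rep) \<in> rep_prod (standard_word ms s ns)" and ns: "sorted_wrt (\<ge>) ns"
  shows "\<exists>c d. has_subdim c d X \<and> (k + 1) * c = (k + 2) * d + excess k ns"
proof -
  obtain u v where uv: "ns = u @ v" "\<forall>n\<in>set u. k < n" "\<forall>n\<in>set v. n \<le> k"
    using descending_split[OF ns] .
  define w where "w = map dim_P ms @ [(s, s)] @ map dim_I u"
  obtain c d where cd: "sum_list (map dim_I v) = (c, d)" by (cases "sum_list (map dim_I v)")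
  have "standard_word ms s ns = w @ map dim_I v" by (simp add: standard_word_def w_def uv)
  then have "X \<in> ext_prod (rep_prod w) (rep_prod (map dim_I v))" using X by (simp add: rep_prod_append)
  also have "\<dots> \<subseteq> ext_prod (Rep (sum_list w)) (Rep (c, d))"
    unfolding cd[symmetric] by (intro ext_prod_mono rep_prod_subset)
  finally have "has_subdim c d X" by (rule has_subdim_of_ext_prod)
  moreover have "(k + 1) * c = (k + 2) * d + excess k v"
    using cd uv(3)
  proof (induction v arbitrary: c d)
    case (Cons n v)
    obtain c' d' where s: "sum_list (map dim_I v) = (c', d')" by (cases "sum_list (map dim_I v)")
    then have "dim_I n + (c', d') = (c, d)" using Cons.prems(1) by simp
    then have "c = n + 1 + c'" "d = n + d'" by (auto simp: dim_I_def)
    moreover have "(k + 1) * (n + 1) = (k + 2) * n + (Suc k - n)" using Cons.prems(2) by simp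
    ultimately show ?case using Cons.IH[OF s] Cons.prems(2) by (simp add: algebra_simps)
  qed (simp add: zero_prod_def)
  moreover have "excess k u = 0" using uv(2) by (induction u) auto
  ultimately show ?thesis by (intro exI[of _ c] exI[of _ d]) (simp add: uv(1) excess_def)
qed

text \<open>The representatives are \<open>preinj n\<close> for the factors \<open>I(n)\<close> and
  a representation with an injective arrow for the others. For descending \<open>ns\<close> the
  resulting bound is the value that \<open>has_subdim_standard\<close> finds in every
  member.\<close>

lemma standard_word_witness:
  "\<exists>X\<in>rep_prod (standard_word ms s ns). euler_bounded k (excess k ns) (X :: 'a::field_char_0 rep)"
proof -
  \<comment> \<open>The index of \<open>dim_I n\<close> is its second entry
    \<open>b\<close>.\<close>
  define \<tau> where "\<tau> = (\<lambda>(a, b). if a \<le> b then 0 else Suc k - b :: nat)"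
  have "\<exists>A\<in>Rep \<alpha>. euler_bounded k (\<tau> \<alpha>) (A :: 'a rep)" if "\<alpha> \<in> set (standard_word ms s ns)" for \<alpha>
  proof -
    have "(\<exists>a b. \<alpha> = (a, b) \<and> a \<le> b) \<or> (\<exists>n. \<alpha> = dim_I n)"
      using that by (auto simp: standard_word_def dim_P_def)
    then consider a b where "\<alpha> = (a, b)" "a \<le> b" | n where "\<alpha> = dim_I n" by blast
    then show ?thesis
    proof cases
      case 1
      then show ?thesis using euler_bounded_wide[of a b k] by (simp add: \<tau>_def)
    next
      case 2
      then show ?thesis using preinj_Rep[of n] euler_bounded_preinj[of k n]
        by (auto simp: \<tau>_def dim_I_def intro!: bexI[of _ "preinj n"])
    qed
  qed
  then have "\<exists>X\<in>rep_prod (standard_word ms s ns).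
      euler_bounded k (sum_list (map \<tau> (standard_word ms s ns))) (X :: 'a rep)"
    using euler_bounded_wide[of 0 0 k] by (intro euler_bounded_rep_prod) blast+
  moreover have "\<tau> (dim_P m) = 0" "\<tau> (s, s) = 0" "\<tau> (dim_I m) = Suc k - m" for m
    by (simp_all add: \<tau>_def dim_P_def dim_I_def)
  then have "sum_list (map \<tau> (standard_word ms s ns)) = excess k ns"
    by (simp add: standard_word_def comp_def excess_def)
  ultimately show ?thesis by simp
qed

text \<open>One representation is tested against both descriptions: it is chosen in the right
  product with all values at most \<open>excess k ns'\<close>, and as a member of the left product
  it attains \<open>excess k ns\<close>.\<close>

lemma excess_le_of_eq:
  assumes "rep_prod (standard_word ms s ns) = (rep_prod (standard_word ms' s' ns') :: 'a::field_char_0 rep set)"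
    and "sorted_wrt (\<ge>) ns"
  shows "excess k ns \<le> excess k ns'"
proof -
  obtain X where X: "X \<in> rep_prod (standard_word ms' s' ns')" "euler_bounded k (excess k ns') (X :: 'a rep)"
    using standard_word_witness by blast
  obtain c d where "has_subdim c d X" "(k + 1) * c = (k + 2) * d + excess k ns"
    using has_subdim_standard[of X ms s ns k] X(1) assms by auto
  then show ?thesis using X(2) unfolding euler_bounded_def by fastforce
qed

lemma excess_Suc: "excess (Suc k) ns = excess k ns + length (filter (\<lambda>n. n \<le> Suc k) ns)"
  by (induction ns) auto

lemma excess_0: "excess 0 ns = length (filter (\<lambda>n. n \<le> 0) ns)"
  by (induction ns) auto

lemma length_filter_Suc:
  "length (filter (\<lambda>n. n \<le> Suc k) ns) = length (filter (\<lambda>n. n \<le> k) ns) + count (mset ns) (Suc k)"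
  by (induction ns) auto

text \<open>First differences in \<open>k\<close> count the entries up to \<open>k\<close>, second
  differences give the multiplicities.\<close>

lemma mset_eq_of_excess:
  assumes "\<And>k. excess k ns = excess k ns'"
  shows "mset ns = mset ns'"
proof -
  have l: "length (filter (\<lambda>n. n \<le> k) ns) = length (filter (\<lambda>n. n \<le> k) ns')" for k
    using assms[of k] assms[of "k - 1"] by (cases k) (simp_all add: excess_0 excess_Suc)
  have 0: "length (filter (\<lambda>n. n \<le> 0) xs) = count (mset xs) 0" for xs :: "nat list"
    by (induction xs) auto
  have "count (mset ns) k = count (mset ns') k" for k
    using l[of k] l[of "k - 1"] 0[of ns] 0[of ns'] by (cases k) (simp_all add: length_filter_Suc)
  then show ?thesis by (rule multiset_eqI)
qed

lemma descending_iff_sorted_rev: "sorted_wrt (\<ge>) xs \<longleftrightarrow> sorted (rev xs)"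
  by (simp add: sorted_wrt_rev)

lemma preinj_part_unique:
  assumes eq: "rep_prod (standard_word ms s ns) = (rep_prod (standard_word ms' s' ns') :: 'a::field_char_0 rep set)"
    and ns: "sorted_wrt (\<ge>) ns" "sorted_wrt (\<ge>) ns'"
  shows "ns = ns'"
proof -
  have "mset ns = mset ns'"
    using excess_le_of_eq[OF eq ns(1)] excess_le_of_eq[OF eq[symmetric] ns(2)]
    by (intro mset_eq_of_excess antisym)
  then have "rev ns = rev ns'"
    using ns unfolding descending_iff_sorted_rev
    by (metis mset_rev properties_for_sort)
  then show ?thesis by simp
qed

lemma standard_word_unique:
  assumes eq: "rep_prod (standard_word ms s ns) = (rep_prod (standard_word ms' s' ns') :: 'a::field_char_0 rep set)"
    and ms: "sorted ms" "sorted ms'" and ns: "sorted_wrt (\<ge>) ns" "sorted_wrt (\<ge>) ns'"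
  shows "ms = ms' \<and> s = s' \<and> ns = ns'"
proof -
  have n: "ns = ns'" by (rule preinj_part_unique[OF eq ns])
  have "rep_prod (standard_word (rev ns) s (rev ms)) =
      (rep_prod (standard_word (rev ns') s' (rev ms')) :: 'a rep set)"
    using arg_cong[OF eq, of "image transpose_rep"] unfolding transpose_rep_prod rev_swap_standard_word .
  then have "rev ms = rev ms'"
    using ms by (intro preinj_part_unique) (simp_all add: descending_iff_sorted_rev)
  then have m: "ms = ms'" by simp
  obtain X where X: "X \<in> (rep_prod (standard_word ms s ns) :: 'a rep set)"
    using standard_word_witness by blast
  have "sum_list (standard_word ms s ns) = sum_list (standard_word ms' s' ns')"
    using X eq rep_prod_subset dimv_Rep by (metis subsetD)
  then have "s = s'" by (simp add: standard_word_def m n)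
  then show ?thesis using m n by simp
qed

theorem theorem11:
  fixes X :: "'a :: {alg_closed_field, field_char_0} rep set"
  assumes "X \<in> composition_monoid"
  shows "\<exists>!t :: nat list \<times> nat \<times> nat list. case t of (ms, s, ns) \<Rightarrow>
    sorted_wrt (\<le>) ms \<and> sorted_wrt (\<ge>) ns \<and>
    X = foldr (\<lambda>A B. A \<otimes>\<^bsub>ext_monoid\<^esub> B)
          (map (\<lambda>m. Rep (dimv (preproj m :: 'a rep))) ms @
           [delta s] @
           map (\<lambda>n. Rep (dimv (preinj n :: 'a rep))) ns)
          \<one>\<^bsub>ext_monoid\<^esub>"
proof -
  obtain w where w: "set w \<subseteq> {(1, 0), (0, 1)}" "X = rep_prod w"
    using composition_monoid_rep_prod[OF assms] by blast
  obtain ms s ns where 1: "rep_prod w = (rep_prod (standard_word ms s ns) :: 'a rep set)"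
    using rep_prod_standard_exists[OF w(1)] by blast
  obtain ms' ns' where 2: "sorted ms'" "sorted_wrt (\<ge>) ns'"
    "rep_prod (standard_word ms s ns) = (rep_prod (standard_word ms' s ns') :: 'a rep set)"
    using rep_prod_sort_standard[of ms s ns] unfolding descending_iff_sorted_rev by blast
  have X: "X = rep_prod (standard_word ms' s ns')" unfolding w(2) 1 2(3) ..
  show ?thesis
    unfolding foldr_standard_word
  proof (rule ex1I[of _ "(ms', s, ns')"])
    fix t :: "nat list \<times> nat \<times> nat list"
    assume "case t of (ms, s, ns) \<Rightarrow> sorted ms \<and> sorted_wrt (\<ge>) ns \<and>
      X = rep_prod (standard_word ms s ns)"
    then obtain ms1 s1 ns1 where t: "t = (ms1, s1, ns1)" "sorted ms1" "sorted_wrt (\<ge>) ns1"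
      "X = rep_prod (standard_word ms1 s1 ns1)" by (cases t) auto
    have "ms1 = ms' \<and> s1 = s \<and> ns1 = ns'"
      using standard_word_unique[OF trans[OF t(4)[symmetric] X] t(2) 2(1) t(3) 2(2)] .
    then show "t = (ms', s, ns')" using t(1) by simp
  qed (use 2 X in simp)
qed

end
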